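(* Let $k$ be a field and let $s\ge 3$ be an integer. There exist a polynomial ring $R$ over $k$ and a squarefree monomial ideal $I\subset R$ such that, for positive integers $t$, $\operatorname{depth} R/I^{(s)} < \operatorname{depth} R/I^{(t)}$ if and only if $t\notin E(s)$, where $$E(s)=\bigcup_{i\ge 1}\{t\in\mathbb{N} \mid i(s-1)+1\le t\le is\}.$$
   Context: For a homogeneous ideal $I$ of a polynomial ring $R$ and $t\ge 0$, the $t$-th symbolic power $I^{(t)}$ is the intersection of the primary components of $I^t$ associated with the minimal primes of $I$. *)

theory Defs
  imports Main "HOL-Library.Poly_Mapping" "HOL-Library.Extended_Nat"
begin

text \<open>Multivariate polynomials over 'k: finitely supported maps from monomials
(finitely supported exponent vectors) to coefficients.
The polynomial ring k[x_0,...,x_{n-1}] is the subset Pn n of polynomials whose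
monomials only involve the variables x_i with i < n.\<close>

type_synonym 'k mpoly = "(nat \<Rightarrow>\<^sub>0 nat) \<Rightarrow>\<^sub>0 'k"

definition Pn :: "nat \<Rightarrow> ('k::field) mpoly set" where
  "Pn n = {p. \<forall>m \<in> Poly_Mapping.keys p. Poly_Mapping.keys m \<subseteq> {..<n}}"

inductive_set ideal_gen :: "nat \<Rightarrow> ('k::field) mpoly set \<Rightarrow> 'k mpoly set"
  for n :: nat and G :: "'k mpoly set" where
  zero: "0 \<in> ideal_gen n G"
| gen: "g \<in> G \<Longrightarrow> g \<in> ideal_gen n G"
| add: "a \<in> ideal_gen n G \<Longrightarrow> b \<in> ideal_gen n G \<Longrightarrow> a + b \<in> ideal_gen n G"
| mult: "r \<in> Pn n \<Longrightarrow> a \<in> ideal_gen n G \<Longrightarrow> r * a \<in> ideal_gen n G"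

definition is_ideal :: "nat \<Rightarrow> ('k::field) mpoly set \<Rightarrow> bool" where
  "is_ideal n J \<longleftrightarrow> J \<subseteq> Pn n \<and> ideal_gen n J = J"

definition is_prime_ideal :: "nat \<Rightarrow> ('k::field) mpoly set \<Rightarrow> bool" where
  "is_prime_ideal n P \<longleftrightarrow> is_ideal n P \<and> P \<noteq> Pn n \<and>
     (\<forall>a\<in>Pn n. \<forall>b\<in>Pn n. a * b \<in> P \<longrightarrow> a \<in> P \<or> b \<in> P)"

definition minimal_primes :: "nat \<Rightarrow> ('k::field) mpoly set \<Rightarrow> 'k mpoly set set" where
  "minimal_primes n I = {P. is_prime_ideal n P \<and> I \<subseteq> P \<and>
     (\<forall>Q. is_prime_ideal n Q \<and> I \<subseteq> Q \<and> Q \<subseteq> P \<longrightarrow> Q = P)}"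

definition ideal_mult :: "nat \<Rightarrow> ('k::field) mpoly set \<Rightarrow> 'k mpoly set \<Rightarrow> 'k mpoly set" where
  "ideal_mult n I J = ideal_gen n {a * b | a b. a \<in> I \<and> b \<in> J}"

fun ideal_pow :: "nat \<Rightarrow> ('k::field) mpoly set \<Rightarrow> nat \<Rightarrow> 'k mpoly set" where
  "ideal_pow n I 0 = Pn n"
| "ideal_pow n I (Suc t) = ideal_mult n (ideal_pow n I t) I"

text \<open>Symbolic power: intersection of the primary components of I^t belonging to the
minimal primes P of I; the P-primary component of I^t (P minimal over I^t) is the
contraction I^t R_P \<inter> R = {f \<in> R. \<exists>u \<in> R - P. u f \<in> I^t}.\<close>
definition symbolic_power :: "nat \<Rightarrow> ('k::field) mpoly set \<Rightarrow> nat \<Rightarrow> 'k mpoly set" where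
  "symbolic_power n I t = Pn n \<inter> (\<Inter>P \<in> minimal_primes n I.
     {f \<in> Pn n. \<exists>u \<in> Pn n - P. u * f \<in> ideal_pow n I t})"

definition max_ideal :: "nat \<Rightarrow> ('k::field) mpoly set" where
  "max_ideal n = {p \<in> Pn n. Poly_Mapping.lookup p 0 = 0}"

definition regular_seq :: "nat \<Rightarrow> ('k::field) mpoly set \<Rightarrow> 'k mpoly list \<Rightarrow> bool" where
  "regular_seq n J fs \<longleftrightarrow> set fs \<subseteq> max_ideal n \<and>
     (\<forall>i < length fs. \<forall>g \<in> Pn n.
        fs ! i * g \<in> ideal_gen n (J \<union> set (take i fs)) \<longrightarrow> g \<in> ideal_gen n (J \<union> set (take i fs)))
     \<and> ideal_gen n (J \<union> set fs) \<noteq> Pn n"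

definition depth :: "nat \<Rightarrow> ('k::field) mpoly set \<Rightarrow> enat" where
  "depth n J = Sup {enat (length fs) | fs. regular_seq n J fs}"

definition sqfree_monomials :: "nat \<Rightarrow> ('k::field) mpoly set" where
  "sqfree_monomials n = {Poly_Mapping.single m 1 | m.
      Poly_Mapping.keys m \<subseteq> {..<n} \<and> (\<forall>i. Poly_Mapping.lookup m i \<le> 1)}"

definition E_set :: "nat \<Rightarrow> nat set" where
  "E_set s = (\<Union>i\<in>{1..}. {t. i * (s - 1) + 1 \<le> t \<and> t \<le> i * s})"

end

theory Submission
  imports Defs
begin

text \<open>
Take \<open>s\<close> disjoint blocks of \<open>s\<close> variables, each consisting of an apex \<open>z\<^sub>j\<close> and \<open>s - 1\<close> body variables, and
let \<open>I\<close> be the intersection of the primes generated by the blocks and by the transversals of the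
bodies (one body variable from each block). A monomial lies in \<open>I\<^sup>(\<^sup>t\<^sup>)\<close> iff its degree on each block and
on each transversal is at least \<open>t\<close>. The differences \<open>z\<^sub>j - z\<^sub>0\<close> form a regular sequence of length \<open>s - 1\<close> on
\<open>R/I\<^sup>(\<^sup>t\<^sup>)\<close>, and the quotient is again a monomial ring. It has a socle element iff some monomial has degree
less than \<open>t\<close> on every body but at least \<open>t\<close> on every transversal. Picking the smallest exponent in each
body, and then the largest exponent \<open>i\<close> among these, gives \<open>i (s - 1) < t \<le> i s\<close>, that is \<open>t \<in> E(s)\<close>;
conversely, all body exponents equal to \<open>i\<close> work. So the depth is \<open>s - 1\<close> for \<open>t \<in> E(s)\<close> and at least
\<open>s\<close> otherwise. That a socle element bounds the length of every regular sequence is seen on Koszul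
cohomology with respect to the variables.
\<close>

text \<open>The shape of \<open>E(s)\<close> comes from a mismatch of two counts: a body has
  \<open>s - 1\<close> variables, while a transversal meets \<open>s\<close> bodies. Constant body
  exponents \<open>i\<close> thus have degree \<open>i (s - 1)\<close> on each body and
  \<open>i s\<close> on each transversal. An apex occurs in its own block only, where it has to
  supply the deficit \<open>t - body\<close>. Identifying the apices therefore merely adds up the
  deficits, which is why the quotient stays monomial. If all deficits are positive, a monomial that
  satisfies the transversal condition and falls short of the total deficit by exactly one is a socle
  element. Outside \<open>E(s)\<close> the transversal condition forces some deficit to vanish, and
  one more regular element can be written down explicitly, over any field and without prime
  avoidance. The obstacle is the upper bound: depth is a supremum over sequences of arbitrary,
  possibly inhomogeneous elements without constant term, so a single maximal sequence proves nothing
  by itself. Koszul cohomology of the variables helps because every such element acts on it as zero.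
  The exponent \<open>s\<close> serves as reference because it lies in \<open>E(s)\<close>, with
  \<open>i = 1\<close>, so its depth is the smallest one.\<close>

section \<open>Polynomials and monomial ideals\<close>

abbreviation keys where "keys \<equiv> Poly_Mapping.keys"
abbreviation lookup where "lookup \<equiv> Poly_Mapping.lookup"
abbreviation single where "single \<equiv> Poly_Mapping.single"

definition X :: "nat \<Rightarrow> ('k::field) mpoly" where
  "X i = single (single i 1) 1"

text \<open>A predicate on exponents replaces a set of generators: intersections of monomial ideals
  become conjunctions, and the regularity proofs treat one conjunct at a time.\<close>

definition mon_ideal :: "nat \<Rightarrow> ((nat \<Rightarrow>\<^sub>0 nat) \<Rightarrow> bool) \<Rightarrow> ('k::field) mpoly set" where
  "mon_ideal n Q = {p \<in> Pn n. \<forall>m\<in>keys p. Q m}"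

lemma keys_plus_nat: "keys (a + b) = keys a \<union> keys (b :: nat \<Rightarrow>\<^sub>0 nat)"
  by (auto simp: in_keys_iff lookup_add)

lemma keys_uminus_eq: "keys (- p) = keys (p :: ('k::field) mpoly)"
  by (auto simp: in_keys_iff)

lemma Pn_0 [simp]: "0 \<in> Pn n"
  by (simp add: Pn_def)

lemma Pn_1 [simp]: "1 \<in> Pn n"
  by (simp add: Pn_def)

lemma Pn_add: "a \<in> Pn n \<Longrightarrow> b \<in> Pn n \<Longrightarrow> a + b \<in> Pn n"
  using keys_add[of a b] by (auto simp: Pn_def)

lemma Pn_uminus: "a \<in> Pn n \<Longrightarrow> - a \<in> Pn n"
  by (simp add: Pn_def keys_uminus_eq)

lemma Pn_diff: "a \<in> Pn n \<Longrightarrow> b \<in> Pn n \<Longrightarrow> a - b \<in> Pn n"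
  using Pn_add[OF _ Pn_uminus, of a n b] by simp

lemma Pn_mult: "a \<in> Pn n \<Longrightarrow> b \<in> Pn n \<Longrightarrow> a * b \<in> Pn n"
  using keys_mult[of a b] by (fastforce simp: Pn_def keys_plus_nat)

lemma Pn_sum: "(\<And>i. i \<in> A \<Longrightarrow> f i \<in> Pn n) \<Longrightarrow> sum f A \<in> Pn n"
  by (induction A rule: infinite_finite_induct) (auto intro: Pn_add)

lemma Pn_single: "keys m \<subseteq> {..<n} \<Longrightarrow> single m c \<in> Pn n"
  by (simp add: Pn_def)

lemma Pn_X: "i < n \<Longrightarrow> X i \<in> Pn n"
  by (simp add: X_def Pn_single)

lemma Pn_keys: "p \<in> Pn n \<Longrightarrow> m \<in> keys p \<Longrightarrow> keys m \<subseteq> {..<n}"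
  by (simp add: Pn_def)

lemma poly_eq_sum_single: "p = (\<Sum>m\<in>keys p. single m (lookup p m))"
  by (rule poly_mapping_eqI)
     (auto simp: lookup_sum lookup_single when_def sum.delta not_in_keys_iff_lookup_eq_zero)

lemma poly_split:
  fixes p :: "('k::field) mpoly"
  obtains q r where "p = q + r" "keys q = {m \<in> keys p. P m}" "keys r = {m \<in> keys p. \<not> P m}"
proof
  define part where "part \<equiv> \<lambda>A. \<Sum>m\<in>A. single m (lookup p m)"
  have lk: "lookup (part A) m = (if m \<in> A then lookup p m else 0)" if "finite A" for A m
    using that by (simp add: part_def lookup_sum lookup_single when_def)
  show "p = part {m \<in> keys p. P m} + part {m \<in> keys p. \<not> P m}"
    by (rule poly_mapping_eqI) (auto simp: lk lookup_add in_keys_iff)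
  show "keys (part {m \<in> keys p. P m}) = {m \<in> keys p. P m}"
    "keys (part {m \<in> keys p. \<not> P m}) = {m \<in> keys p. \<not> P m}"
    by (auto simp: lk in_keys_iff split: if_splits)
qed

lemma exponent_split:
  fixes m :: "nat \<Rightarrow>\<^sub>0 nat"
  assumes "i \<in> keys m"
  obtains m' where "m = m' + single i 1" "keys m' \<subseteq> keys m"
proof
  show "m = (m - single i 1) + single i 1"
    using assms
    by (intro poly_mapping_eqI) (auto simp: lookup_add lookup_minus lookup_single when_def in_keys_iff)
  show "keys (m - single i 1) \<subseteq> keys m"
    by (auto simp: lookup_minus in_keys_iff)
qed

lemma lookup_single_mult:
  fixes g :: "('k::field) mpoly"
  shows "lookup (single a c * g) (a + m) = c * lookup g m"
  by (simp add: lookup_mult lookup_single when_mult mult_when)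

section \<open>Ideals and monomial ideals\<close>

lemma ideal_gen_least:
  assumes "is_ideal n A" "G \<subseteq> A"
  shows "ideal_gen n G \<subseteq> A"
proof
  fix x assume "x \<in> ideal_gen n G"
  then have "x \<in> ideal_gen n A"
    by (induction) (use assms in \<open>auto intro: ideal_gen.intros\<close>)
  then show "x \<in> A" using assms by (simp add: is_ideal_def)
qed

lemma is_idealI:
  assumes "A \<subseteq> Pn n" "0 \<in> A" "\<And>a b. a \<in> A \<Longrightarrow> b \<in> A \<Longrightarrow> a + b \<in> A"
    "\<And>r a. r \<in> Pn n \<Longrightarrow> a \<in> A \<Longrightarrow> r * a \<in> A"
  shows "is_ideal n A"
proof -
  have "x \<in> A" if "x \<in> ideal_gen n A" for x
    using that by induction (use assms in auto)
  then show ?thesis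
    using assms(1) by (auto simp: is_ideal_def intro: ideal_gen.gen)
qed

lemma is_ideal_ideal_gen:
  assumes "G \<subseteq> Pn n"
  shows "is_ideal n (ideal_gen n G)"
proof (rule is_idealI)
  show "ideal_gen n G \<subseteq> Pn n"
  proof
    fix x assume "x \<in> ideal_gen n G"
    then show "x \<in> Pn n"
      by induction (use assms in \<open>auto intro: Pn_add Pn_mult\<close>)
  qed
qed (auto intro: ideal_gen.intros)

lemma is_ideal_subset: "is_ideal n A \<Longrightarrow> A \<subseteq> Pn n"
  by (simp add: is_ideal_def)

lemma is_ideal_0: "is_ideal n A \<Longrightarrow> 0 \<in> A"
  by (metis is_ideal_def ideal_gen.zero)

lemma is_ideal_add: "is_ideal n A \<Longrightarrow> a \<in> A \<Longrightarrow> b \<in> A \<Longrightarrow> a + b \<in> A"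
  by (metis is_ideal_def ideal_gen.add ideal_gen.gen)

lemma is_ideal_mult: "is_ideal n A \<Longrightarrow> r \<in> Pn n \<Longrightarrow> a \<in> A \<Longrightarrow> r * a \<in> A"
  by (metis is_ideal_def ideal_gen.mult ideal_gen.gen)

lemma is_ideal_uminus: "is_ideal n A \<Longrightarrow> a \<in> A \<Longrightarrow> - a \<in> A"
  using is_ideal_mult[of n A "-1" a] by (simp add: Pn_uminus)

lemma is_ideal_diff: "is_ideal n A \<Longrightarrow> a \<in> A \<Longrightarrow> b \<in> A \<Longrightarrow> a - b \<in> A"
  using is_ideal_add[of n A a "-b"] is_ideal_uminus by fastforce

lemma is_ideal_sum: "is_ideal n A \<Longrightarrow> (\<And>i. i \<in> I \<Longrightarrow> f i \<in> A) \<Longrightarrow> sum f I \<in> A"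
  by (induction I rule: infinite_finite_induct) (auto intro: is_ideal_add is_ideal_0)

lemma is_ideal_UNIV_iff: "is_ideal n A \<Longrightarrow> A = Pn n \<longleftrightarrow> 1 \<in> A"
proof
  assume A: "is_ideal n A" "1 \<in> A"
  have "r \<in> A" if "r \<in> Pn n" for r
    using is_ideal_mult[OF A(1) that A(2)] by simp
  then show "A = Pn n" using is_ideal_subset[OF A(1)] by auto
qed simp

lemma is_ideal_max_ideal: "is_ideal n (max_ideal n :: ('k::field) mpoly set)"
proof (rule is_idealI)
  fix r a :: "'k mpoly"
  assume ra: "r \<in> Pn n" "a \<in> max_ideal n"
  have "0 \<notin> keys (r * a)"
  proof
    assume "0 \<in> keys (r * a)"
    then obtain u v where "u \<in> keys r" "v \<in> keys a" "u + v = 0"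
      using keys_mult[of r a] by force
    moreover from this have "v = 0"
      by (metis Un_empty keys_plus_nat keys_zero keys_eq_empty)
    ultimately show False using ra by (simp add: max_ideal_def in_keys_iff)
  qed
  then show "r * a \<in> max_ideal n"
    using ra by (simp add: max_ideal_def Pn_mult in_keys_iff)
qed (auto simp: max_ideal_def lookup_add intro: Pn_add)

lemma is_ideal_mon_ideal:
  assumes up: "\<And>a b. Q a \<Longrightarrow> Q (a + b)"
  shows "is_ideal n (mon_ideal n Q :: ('k::field) mpoly set)"
proof (rule is_idealI)
  fix r a :: "'k mpoly" assume "r \<in> Pn n" "a \<in> mon_ideal n Q"
  moreover have "Q m" if m: "m \<in> keys (r * a)" for m
  proof -
    obtain u v where "u \<in> keys r" "v \<in> keys a" "m = u + v"
      using m keys_mult[of r a] by auto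
    then show "Q m" using calculation up[of v u] by (simp add: mon_ideal_def add.commute)
  qed
  ultimately show "r * a \<in> mon_ideal n Q"
    by (simp add: mon_ideal_def Pn_mult)
next
  fix a b :: "'k mpoly" assume "a \<in> mon_ideal n Q" "b \<in> mon_ideal n Q"
  then show "a + b \<in> mon_ideal n Q"
    using keys_add[of a b] by (auto simp: mon_ideal_def Pn_add)
qed (auto simp: mon_ideal_def)

lemma mon_ideal_subsetI:
  fixes A :: "('k::field) mpoly set"
  assumes "is_ideal n A" "\<And>m c. Q m \<Longrightarrow> keys m \<subseteq> {..<n} \<Longrightarrow> single m c \<in> A"
  shows "mon_ideal n Q \<subseteq> A"
proof
  fix p :: "'k mpoly" assume p: "p \<in> mon_ideal n Q"
  have "(\<Sum>m\<in>keys p. single m (lookup p m)) \<in> A"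
    by (rule is_ideal_sum[OF assms(1)]) (use p in \<open>auto simp: mon_ideal_def intro!: assms(2) dest: Pn_keys\<close>)
  then show "p \<in> A" by (simp flip: poly_eq_sum_single)
qed

lemma single_in_mon_ideal: "Q m \<Longrightarrow> keys m \<subseteq> {..<n} \<Longrightarrow> single m c \<in> mon_ideal n Q"
  by (simp add: mon_ideal_def Pn_single)

text \<open>In a key of \<open>g\<close> outside \<open>Q\<close> with maximal \<open>y\<close>-exponent, the term \<open>X y\<close> cannot be cancelled by \<open>h\<close>.\<close>

lemma mon_ideal_cancel:
  fixes g h :: "('k::field) mpoly"
  assumes up: "\<And>a b. Q a \<Longrightarrow> Q (a + b)" and indep: "\<And>m. Q (m + single y 1) \<Longrightarrow> Q m"
    and h: "\<And>m. m \<in> keys h \<Longrightarrow> y \<notin> keys m"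
    and g: "g \<in> Pn n" and fg: "(X y + h) * g \<in> mon_ideal n Q"
  shows "g \<in> mon_ideal n Q"
proof (rule ccontr)
  assume "g \<notin> mon_ideal n Q"
  define B where "B = {m \<in> keys g. \<not> Q m}"
  have "B \<noteq> {}" "finite B"
    using g \<open>g \<notin> mon_ideal n Q\<close> by (auto simp: B_def mon_ideal_def)
  have "Max ((\<lambda>m. lookup m y) ` B) \<in> (\<lambda>m. lookup m y) ` B"
    using \<open>B \<noteq> {}\<close> \<open>finite B\<close> by (intro Max_in) auto
  then obtain m where m: "m \<in> B" and Max: "lookup m y = Max ((\<lambda>m. lookup m y) ` B)" by auto
  have max: "lookup b y \<le> lookup m y" if "b \<in> B" for b
    using that \<open>finite B\<close> by (simp add: Max)
  define w where "w = single y 1 + m"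
  have "\<not> Q w" using m indep by (auto simp: w_def B_def add.commute)
  then have "lookup ((X y + h) * g) w = 0"
    using fg by (auto simp: mon_ideal_def in_keys_iff)
  moreover have "lookup (X y * g) w = lookup g m"
    by (simp add: X_def w_def lookup_single_mult)
  moreover have "lookup (h * g) w = 0"
  proof (rule ccontr)
    assume "lookup (h * g) w \<noteq> 0"
    then have "w \<in> keys (h * g)" by (simp add: in_keys_iff)
    then obtain a b where ab: "a \<in> keys h" "b \<in> keys g" "w = a + b"
      using keys_mult[of h g] by auto
    from h[OF ab(1)] have "lookup a y = 0" by (simp add: in_keys_iff)
    then have "lookup b y = Suc (lookup m y)"
      using arg_cong[OF ab(3), of "\<lambda>w. lookup w y"] by (simp add: w_def lookup_add)
    then have "Q b" using max[of b] ab(2) by (auto simp: B_def)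
    then show False using up[of b a] \<open>\<not> Q w\<close> ab(3) by (simp add: add.commute)
  qed
  ultimately have "lookup g m = 0" by (simp add: distrib_right lookup_add)
  then show False using m by (simp add: B_def in_keys_iff)
qed

section \<open>Powers of primes generated by variables\<close>

definition deg_on :: "nat set \<Rightarrow> (nat \<Rightarrow>\<^sub>0 nat) \<Rightarrow> nat" where
  "deg_on C m = (\<Sum>i\<in>C. lookup m i)"

lemma deg_on_add: "deg_on C (a + b) = deg_on C a + deg_on C b"
  by (simp add: deg_on_def lookup_add sum.distrib)

lemma deg_on_single: "finite C \<Longrightarrow> deg_on C (single i c) = (if i \<in> C then c else 0)"
  by (simp add: deg_on_def lookup_single when_def)

lemma deg_on_eq_0_iff: "finite C \<Longrightarrow> deg_on C m = 0 \<longleftrightarrow> keys m \<inter> C = {}"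
  by (auto simp: deg_on_def in_keys_iff)

text \<open>For finite \<open>C\<close> inside \<open>{..<n}\<close> this is the \<open>t\<close>-th
  power of the prime generated by the variables in \<open>C\<close>; \<open>t = 1\<close> gives the
  prime itself.\<close>

abbreviation deg_ideal :: "nat \<Rightarrow> nat set \<Rightarrow> nat \<Rightarrow> ('k::field) mpoly set" where
  "deg_ideal n C t \<equiv> mon_ideal n (\<lambda>m. t \<le> deg_on C m)"

lemma is_ideal_deg_ideal: "is_ideal n (deg_ideal n C t)"
  by (rule is_ideal_mon_ideal) (simp add: deg_on_add)

text \<open>Comparison of the components of lowest \<open>C\<close>-degree; their product does not vanish.\<close>

lemma deg_ideal_primary:
  fixes u f :: "('k::field) mpoly"
  assumes u: "u \<in> Pn n" "u \<notin> deg_ideal n C 1" and f: "f \<in> Pn n"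
    and uf: "u * f \<in> deg_ideal n C t"
  shows "f \<in> deg_ideal n C t"
proof (rule ccontr)
  assume nf: "f \<notin> deg_ideal n C t"
  define d where "d = Min (deg_on C ` keys f)"
  from nf f obtain m where m: "m \<in> keys f" "deg_on C m < t"
    by (auto simp: mon_ideal_def)
  have dle: "d \<le> deg_on C b" if "b \<in> keys f" for b
    using that by (simp add: d_def)
  have "d \<in> deg_on C ` keys f" unfolding d_def by (rule Min_in) (use m in auto)
  have "d < t" using dle[OF m(1)] m(2) by simp
  obtain u0 u1 where u01: "u = u0 + u1" "keys u0 = {a \<in> keys u. deg_on C a = 0}"
      "keys u1 = {a \<in> keys u. deg_on C a \<noteq> 0}" by (rule poly_split[of u "\<lambda>a. deg_on C a = 0"])
  obtain f0 f1 where f01: "f = f0 + f1" "keys f0 = {a \<in> keys f. deg_on C a = d}"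
      "keys f1 = {a \<in> keys f. deg_on C a \<noteq> d}" by (rule poly_split[of f "\<lambda>a. deg_on C a = d"])
  have "u0 \<noteq> 0" using u u01(2) by (force simp: mon_ideal_def)
  moreover have "f0 \<noteq> 0" using \<open>d \<in> _\<close> f01(2) by force
  ultimately have "u0 * f0 \<noteq> 0" by simp
  then obtain w where w: "w \<in> keys (u0 * f0)" by (metis ex_in_conv keys_eq_empty)
  then have dw: "deg_on C w = d"
    using keys_mult[of u0 f0] u01(2) f01(2) by (force simp: deg_on_add)
  have "u * f = u0 * f0 + (u0 * f1 + u1 * f)"
    using u01(1) f01(1) by (simp add: algebra_simps)
  moreover have "lookup (u0 * f1) w = 0"
  proof (rule ccontr)
    assume "lookup (u0 * f1) w \<noteq> 0"
    then obtain a b where "a \<in> keys u0" "b \<in> keys f1" "w = a + b"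
      using keys_mult[of u0 f1] by (auto simp: in_keys_iff)
    then show False using u01 f01 dw by (simp add: deg_on_add)
  qed
  moreover have "lookup (u1 * f) w = 0"
  proof (rule ccontr)
    assume "lookup (u1 * f) w \<noteq> 0"
    then obtain a b where "a \<in> keys u1" "b \<in> keys f" "w = a + b"
      using keys_mult[of u1 f] by (auto simp: in_keys_iff)
    then show False using u01 dle[of b] dw by (simp add: deg_on_add)
  qed
  ultimately have "w \<in> keys (u * f)" using w by (simp add: in_keys_iff lookup_add)
  then show False using uf dw \<open>d < t\<close> by (auto simp: mon_ideal_def)
qed

section \<open>Symbolic powers of squarefree monomial ideals\<close>

declare One_nat_def [simp del]

text \<open>The supports are the vertex covers of the hypergraph \<open>\<C>\<close>, so these
  monomials generate its cover ideal, the intersection of the primes generated by the members.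
  Nonminimal covers are kept, which makes membership a plain intersection test.\<close>

definition cover_gens :: "nat \<Rightarrow> nat set set \<Rightarrow> ('k::field) mpoly set" where
  "cover_gens n \<C> = {single m 1 | m. keys m \<subseteq> {..<n} \<and> (\<forall>i. lookup m i \<le> 1) \<and>
     (\<forall>C\<in>\<C>. keys m \<inter> C \<noteq> {})}"

lemma deg_ideal_1: 
  assumes "finite C"
  shows "p \<in> deg_ideal n C 1 \<longleftrightarrow> p \<in> Pn n \<and> (\<forall>m\<in>keys p. keys m \<inter> C \<noteq> {})"
proof -
  have "1 \<le> deg_on C m \<longleftrightarrow> keys m \<inter> C \<noteq> {}" for m
    using deg_on_eq_0_iff[OF assms, of m] by linarith
  then show ?thesis by (simp add: mon_ideal_def)
qed

definition indicator_exp :: "nat set \<Rightarrow> (nat \<Rightarrow>\<^sub>0 nat)" where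
  "indicator_exp A = (\<Sum>i\<in>A. single i 1)"

lemma lookup_indicator_exp: "finite A \<Longrightarrow> lookup (indicator_exp A) i = (if i \<in> A then 1 else 0)"
  by (simp add: indicator_exp_def lookup_sum lookup_single when_def)

lemma keys_indicator_exp: "finite A \<Longrightarrow> keys (indicator_exp A) = A"
  by (auto simp: in_keys_iff lookup_indicator_exp split: if_splits)

lemma finite_cover_gens: "finite (cover_gens n \<C> :: ('k::field) mpoly set)"
proof (rule finite_subset)
  show "cover_gens n \<C> \<subseteq> (\<lambda>A. single (indicator_exp A) (1::'k)) ` Pow {..<n}"
  proof
    fix p :: "'k mpoly" assume "p \<in> cover_gens n \<C>"
    then obtain m where m: "p = single m 1" "keys m \<subseteq> {..<n}" "\<forall>i. lookup m i \<le> 1"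
      by (auto simp: cover_gens_def)
    have "lookup m i = lookup (indicator_exp (keys m)) i" for i
      using spec[OF m(3), of i] by (auto simp: lookup_indicator_exp in_keys_iff le_Suc_eq)
    then have "m = indicator_exp (keys m)" by (rule poly_mapping_eqI)
    then show "p \<in> (\<lambda>A. single (indicator_exp A) 1) ` Pow {..<n}" using m by (metis PowI image_eqI)
  qed
qed simp

lemma cover_gens_sqfree: "cover_gens n \<C> \<subseteq> sqfree_monomials n"
  by (auto simp: cover_gens_def sqfree_monomials_def)

lemma indicator_in_cover_gens:
  assumes "A \<subseteq> {..<n}" "\<And>C. C \<in> \<C> \<Longrightarrow> A \<inter> C \<noteq> {}"
  shows "single (indicator_exp A) 1 \<in> cover_gens n \<C>"
proof -
  have "finite A" using assms(1) finite_subset by blast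
  then show ?thesis
    using assms unfolding cover_gens_def
    by (auto intro!: exI[of _ "indicator_exp A"] simp: keys_indicator_exp lookup_indicator_exp)
qed

lemma prod_X: "finite A \<Longrightarrow> (\<Prod>i\<in>A. X i) = (single (indicator_exp A) 1 :: ('k::field) mpoly)"
  by (induction A rule: finite_induct) (auto simp: indicator_exp_def X_def mult_single)

text \<open>The antichain condition makes the prime of every member minimal over the cover ideal, so
  that each member contributes its own component to the symbolic power.\<close>

locale cover_family =
  fixes n :: nat and \<C> :: "nat set set"
  assumes sub: "C \<in> \<C> \<Longrightarrow> C \<subseteq> {..<n}"
    and antichain: "C \<in> \<C> \<Longrightarrow> D \<in> \<C> \<Longrightarrow> C \<subseteq> D \<Longrightarrow> C = D"
begin

abbreviation I :: "('k::field) mpoly set" where "I \<equiv> ideal_gen n (cover_gens n \<C>)"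

lemma finite_C: "C \<in> \<C> \<Longrightarrow> finite C"
  using sub finite_subset by blast

lemma is_ideal_I: "is_ideal n (I :: ('k::field) mpoly set)"
  by (rule is_ideal_ideal_gen) (auto simp: cover_gens_def intro: Pn_single)

lemma I_subset: 
  assumes "C \<in> \<C>"
  shows "I \<subseteq> (deg_ideal n C 1 :: ('k::field) mpoly set)"
proof (rule ideal_gen_least[OF is_ideal_deg_ideal])
  show "cover_gens n \<C> \<subseteq> (deg_ideal n C 1 :: 'k mpoly set)"
    using assms finite_C[OF assms]
    unfolding cover_gens_def
    by (auto simp: deg_ideal_1 Pn_single simp del: One_nat_def)
qed

lemma is_ideal_pow_I: "is_ideal n (ideal_pow n (I :: ('k::field) mpoly set) t)"
proof (induction t)
  case 0
  then show ?case by (auto intro!: is_idealI Pn_add Pn_mult)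
next
  case (Suc t)
  then show ?case
    using is_ideal_subset[OF is_ideal_I] is_ideal_subset
    by (auto simp: ideal_mult_def intro!: is_ideal_ideal_gen Pn_mult)
qed

lemma pow_I_subset:
  assumes "C \<in> \<C>"
  shows "ideal_pow n (I :: ('k::field) mpoly set) t \<subseteq> deg_ideal n C t"
proof (induction t)
  case 0
  then show ?case by (simp add: mon_ideal_def)
next
  case (Suc t)
  have prod: "a * b \<in> deg_ideal n C (Suc t)"
    if "a \<in> ideal_pow n I t" "b \<in> I" for a b :: "'k mpoly"
  proof -
    have a: "a \<in> deg_ideal n C t" and b: "b \<in> deg_ideal n C 1"
      using that Suc I_subset[OF assms] by auto
    have "Suc t \<le> deg_on C m" if m: "m \<in> keys (a * b)" for m
    proof -
      obtain u v where "u \<in> keys a" "v \<in> keys b" "m = u + v"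
        using m keys_mult[of a b] by auto
      then have "t \<le> deg_on C u" "1 \<le> deg_on C v" "m = u + v"
        using a b by (auto simp: mon_ideal_def)
      then show ?thesis by (simp add: deg_on_add)
    qed
    then show ?thesis using a b by (simp add: mon_ideal_def Pn_mult)
  qed
  show ?case
    unfolding ideal_pow.simps ideal_mult_def
    by (rule ideal_gen_least[OF is_ideal_deg_ideal]) (use prod in blast)
qed

lemma prime_deg_ideal:
  assumes "C \<in> \<C>"
  shows "is_prime_ideal n (deg_ideal n C 1 :: ('k::field) mpoly set)"
  unfolding is_prime_ideal_def
proof (intro conjI ballI impI)
  have "(1 :: 'k mpoly) \<notin> deg_ideal n C 1"
    by (simp add: mon_ideal_def deg_on_def)
  then show "deg_ideal n C 1 \<noteq> (Pn n :: 'k mpoly set)" using Pn_1 by metis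
next
  fix a b :: "'k mpoly" assume "a \<in> Pn n" "b \<in> Pn n" "a * b \<in> deg_ideal n C 1"
  then show "a \<in> deg_ideal n C 1 \<or> b \<in> deg_ideal n C 1"
    using deg_ideal_primary by blast
qed (rule is_ideal_deg_ideal)

text \<open>Otherwise each member \<open>C\<close> has a variable \<open>v C\<close> outside
  \<open>P\<close>. The set of these variables meets every member, so their product is one of the
  generators of \<open>I\<close> and lies in \<open>P\<close>, against primality.\<close>

lemma prime_contains:
  fixes P :: "('k::field) mpoly set"
  assumes P: "is_prime_ideal n P" "I \<subseteq> P"
  shows "\<exists>C\<in>\<C>. deg_ideal n C 1 \<subseteq> P"
proof (rule ccontr)
  assume no: "\<not> ?thesis"
  have idP: "is_ideal n P" using P by (simp add: is_prime_ideal_def)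
  have "\<exists>i\<in>C. (X i :: 'k mpoly) \<notin> P" if C: "C \<in> \<C>" for C
  proof (rule ccontr)
    assume all: "\<not> ?thesis"
    have "deg_ideal n C 1 \<subseteq> P"
    proof (rule mon_ideal_subsetI[OF idP])
      fix m and c :: 'k assume m: "1 \<le> deg_on C m" "keys m \<subseteq> {..<n}"
      then obtain i where i: "i \<in> C" "i \<in> keys m"
        using deg_on_eq_0_iff[OF finite_C[OF C], of m] by auto
      obtain m' where m': "m = m' + single i 1" "keys m' \<subseteq> keys m"
        using exponent_split[OF i(2)] by metis
      have "single m c = single m' c * X i" by (simp add: m' X_def mult_single)
      also have "\<dots> \<in> P"
        using all i m m' by (intro is_ideal_mult[OF idP] Pn_single) auto
      finally show "single m c \<in> P" .
    qed
    then show False using no C by auto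
  qed
  then obtain v where v: "\<And>C. C \<in> \<C> \<Longrightarrow> v C \<in> C \<and> (X (v C) :: 'k mpoly) \<notin> P" by metis
  have A: "v ` \<C> \<subseteq> {..<n}" using v sub by blast
  then have finA: "finite (v ` \<C>)" using finite_subset by blast
  have notin: "(\<Prod>i\<in>B. X i) \<notin> P" if "finite B" "B \<subseteq> v ` \<C>" for B
    using that
  proof (induction B rule: finite_induct)
    case empty
    have "1 \<notin> P" using P(1) is_ideal_UNIV_iff[OF idP] by (auto simp: is_prime_ideal_def)
    then show ?case by simp
  next
    case (insert i B)
    have "(\<Prod>i\<in>B. X i) \<in> (Pn n :: 'k mpoly set)"
      using insert.prems A unfolding prod_X[OF insert.hyps(1)]
      by (intro Pn_single) (auto simp: keys_indicator_exp[OF insert.hyps(1)])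
    moreover have "X i \<in> (Pn n :: 'k mpoly set)" "X i \<notin> P"
      using insert A v by (auto intro: Pn_X)
    ultimately show ?case
      using P(1) insert unfolding is_prime_ideal_def by (metis insert_subset prod.insert)
  qed
  have "single (indicator_exp (v ` \<C>)) 1 \<in> I"
    using A v by (intro ideal_gen.gen indicator_in_cover_gens) auto
  then have "(\<Prod>i\<in>v ` \<C>. X i) \<in> P" using P(2) by (auto simp: prod_X[OF finA])
  then show False using notin[OF finA] by blast
qed

lemma deg_ideal_mono_imp:
  assumes "C \<in> \<C>" "D \<in> \<C>" "deg_ideal n C 1 \<subseteq> (deg_ideal n D 1 :: ('k::field) mpoly set)"
  shows "C = D"
proof (rule antichain[OF assms(1,2)], rule subsetI)
  fix i assume i: "i \<in> C"
  have "(X i :: 'k mpoly) \<in> deg_ideal n C 1"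
    using i sub[OF assms(1)] Pn_X[of i n, where 'a='k]
    by (auto simp: X_def deg_ideal_1[OF finite_C[OF assms(1)]])
  then have "(X i :: 'k mpoly) \<in> deg_ideal n D 1" using assms(3) by auto
  then show "i \<in> D"
    using deg_ideal_1[OF finite_C[OF assms(2)], of "X i :: 'k mpoly" n] by (simp add: X_def)
qed

lemma minimal_primes_I:
  "minimal_primes n (I :: ('k::field) mpoly set) = (\<lambda>C. deg_ideal n C 1) ` \<C>"
proof (intro equalityI subsetI)
  fix P :: "'k mpoly set" assume P: "P \<in> minimal_primes n I"
  then obtain C where "C \<in> \<C>" "deg_ideal n C 1 \<subseteq> P"
    using prime_contains[of P] by (auto simp: minimal_primes_def)
  moreover from this have "is_prime_ideal n (deg_ideal n C 1 :: 'k mpoly set)" "I \<subseteq> (deg_ideal n C 1 :: 'k mpoly set)"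
    using prime_deg_ideal I_subset by auto
  ultimately show "P \<in> (\<lambda>C. deg_ideal n C 1) ` \<C>"
    using P unfolding minimal_primes_def by blast
next
  fix P :: "'k mpoly set" assume "P \<in> (\<lambda>C. deg_ideal n C 1) ` \<C>"
  then obtain C where C: "C \<in> \<C>" "P = deg_ideal n C 1" by auto
  have "Q = P" if Q: "is_prime_ideal n Q" "I \<subseteq> Q" "Q \<subseteq> P" for Q
  proof -
    obtain D where "D \<in> \<C>" "deg_ideal n D 1 \<subseteq> Q" using prime_contains[OF Q(1,2)] by auto
    then show ?thesis using Q(3) C deg_ideal_mono_imp[of D C] by auto
  qed
  then show "P \<in> minimal_primes n I"
    using C prime_deg_ideal I_subset unfolding minimal_primes_def by auto
qed

lemma keys_sum_indicator_exp:
  assumes "A \<subseteq> {..<n}"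
  shows "keys (\<Sum>i<t. indicator_exp A :: nat \<Rightarrow>\<^sub>0 nat) \<subseteq> A"
proof -
  have "finite A" using assms finite_subset by blast
  then show ?thesis by (auto simp: in_keys_iff lookup_sum lookup_indicator_exp simp del: sum_constant split: if_splits)
qed

text \<open>By the antichain property, a variable of \<open>C\<close> times all variables outside \<open>C\<close> lies in \<open>I\<close>.\<close>

lemma cofactor_in_pow_I:
  assumes "C \<in> \<C>" "t \<le> deg_on C m" "keys m \<subseteq> {..<n}"
  shows "single (m + (\<Sum>i<t. indicator_exp ({..<n} - C))) 1 \<in> ideal_pow n (I :: ('k::field) mpoly set) t"
  using assms(2,3)
proof (induction t arbitrary: m)
  case 0
  then show ?case by (simp add: Pn_single)
next
  case (Suc t)
  have fC: "finite C" by (rule finite_C[OF assms(1)])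
  obtain v where v: "v \<in> C" "v \<in> keys m"
    using Suc.prems(1) deg_on_eq_0_iff[OF fC, of m] by auto
  obtain m' where m': "m = m' + single v 1" "keys m' \<subseteq> keys m"
    using exponent_split[OF v(2)] by metis
  have "deg_on C m = Suc (deg_on C m')"
    unfolding m'(1) using v fC by (simp add: deg_on_add deg_on_single)
  then have 1: "single (m' + (\<Sum>i<t. indicator_exp ({..<n} - C))) 1 \<in> ideal_pow n (I :: 'k mpoly set) t"
    using Suc m' by auto
  have "D \<inter> insert v ({..<n} - C) \<noteq> {}" if "D \<in> \<C>" for D
    using antichain[OF that assms(1)] sub[OF that] v by blast
  then have "single (indicator_exp (insert v ({..<n} - C))) 1 \<in> (I :: 'k mpoly set)"
    using v sub[OF assms(1)] by (intro ideal_gen.gen indicator_in_cover_gens) auto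
  moreover have "indicator_exp (insert v ({..<n} - C)) = single v 1 + indicator_exp ({..<n} - C)"
    using v by (simp add: indicator_exp_def)
  ultimately have 2: "single (single v 1 + indicator_exp ({..<n} - C)) 1 \<in> (I :: 'k mpoly set)" by simp
  have "single (m' + (\<Sum>i<t. indicator_exp ({..<n} - C))) 1 *
      single (single v 1 + indicator_exp ({..<n} - C)) 1 \<in> ideal_pow n (I :: 'k mpoly set) (Suc t)"
    using 1 2 by (auto simp: ideal_mult_def intro!: ideal_gen.gen)
  then show ?case by (simp add: mult_single m' ac_simps del: sum_constant ideal_pow.simps)
qed

lemma symbolic_power_I:
  assumes "\<C> \<noteq> {}"
  shows "symbolic_power n (I :: ('k::field) mpoly set) t = mon_ideal n (\<lambda>m. \<forall>C\<in>\<C>. t \<le> deg_on C m)"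
proof -
  have eq: "{f \<in> Pn n. \<exists>u \<in> Pn n - deg_ideal n C 1. u * f \<in> ideal_pow n I t}
      = (deg_ideal n C t :: 'k mpoly set)" (is "?L = ?R") if C: "C \<in> \<C>" for C
  proof
    show "?L \<subseteq> ?R" using deg_ideal_primary pow_I_subset[OF C] by blast
    \<comment> \<open>One multiplier has to serve all \<open>f\<close> at once, since
      \<open>f\<close> is a sum of terms. The \<open>t\<close>-th power of the product of all
      variables outside \<open>C\<close> avoids the prime of \<open>C\<close> and carries every
      monomial of \<open>C\<close>-degree at least \<open>t\<close> into the power of
      \<open>I\<close>. With \<open>u\<close> fixed, the admissible \<open>f\<close> form an ideal,
      and testing monomials is enough.\<close>
    define e where "e = (\<Sum>i<t. indicator_exp ({..<n} - C))"
    define u :: "'k mpoly" where "u = single e 1"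
    have ke: "keys e \<subseteq> {..<n} - C" unfolding e_def by (rule keys_sum_indicator_exp) auto
    have u: "u \<in> Pn n - deg_ideal n C 1"
      using ke deg_ideal_1[OF finite_C[OF C], of u] by (auto simp: u_def intro!: Pn_single)
    have idA: "is_ideal n {f \<in> Pn n. u * f \<in> ideal_pow n I t}"
    proof (rule is_idealI)
      fix r a :: "'k mpoly" assume "r \<in> Pn n" "a \<in> {f \<in> Pn n. u * f \<in> ideal_pow n I t}"
      then show "r * a \<in> {f \<in> Pn n. u * f \<in> ideal_pow n I t}"
        using is_ideal_mult[OF is_ideal_pow_I, of r "u * a" t]
        by (simp add: Pn_mult mult.left_commute)
    qed (auto simp: distrib_left intro: Pn_add is_ideal_add[OF is_ideal_pow_I] is_ideal_0[OF is_ideal_pow_I])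
    have "?R \<subseteq> {f \<in> Pn n. u * f \<in> ideal_pow n I t}"
    proof (rule mon_ideal_subsetI[OF idA])
      fix m and c :: 'k assume m: "t \<le> deg_on C m" "keys m \<subseteq> {..<n}"
      have "u * single m c = single 0 c * single (m + e) 1"
        by (simp add: u_def mult_single add.commute)
      also have "\<dots> \<in> ideal_pow n I t"
        using cofactor_in_pow_I[OF C m]
        by (intro is_ideal_mult[OF is_ideal_pow_I] Pn_single) (auto simp: e_def)
      finally show "single m c \<in> {f \<in> Pn n. u * f \<in> ideal_pow n I t}"
        using m by (simp add: Pn_single)
    qed
    then show "?R \<subseteq> ?L" using u by auto
  qed
  have "symbolic_power n I t = Pn n \<inter> (\<Inter>C\<in>\<C>. deg_ideal n C t :: 'k mpoly set)"
    unfolding symbolic_power_def minimal_primes_I image_image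
    by (intro arg_cong2[where f="(\<inter>)"] INF_cong refl eq)
  then show ?thesis
    using assms by (auto simp: mon_ideal_def)
qed

lemma I_proper:
  assumes "\<C> \<noteq> {}"
  shows "I \<noteq> (Pn n :: ('k::field) mpoly set)"
proof -
  obtain C where C: "C \<in> \<C>" using assms by auto
  show ?thesis using prime_deg_ideal[OF C, where 'k='k] I_subset[OF C, where 'k='k]
      is_ideal_subset[OF is_ideal_deg_ideal, of n 1 C, where 'a='k]
    by (auto simp: is_prime_ideal_def)
qed

end

section \<open>Koszul cohomology and depth\<close>

definition koszul_sign :: "nat \<Rightarrow> nat set \<Rightarrow> ('k::field) mpoly" where
  "koszul_sign i S = (-1) ^ card {j \<in> S. j < i}"

text \<open>A cochain \<open>c\<close> stands for the sum of the \<open>c S\<close> times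
  \<open>e_S\<close> in the exterior algebra, and \<open>koszul_d\<close> is left multiplication by
  the sum of the \<open>X i\<close> times \<open>e_i\<close>; the sign moves \<open>e_i\<close> to
  its place in \<open>S\<close>. Cochains of all degrees are kept in one total function, the degree
  being the size of \<open>S\<close>.\<close>

definition koszul_d :: "(nat set \<Rightarrow> ('k::field) mpoly) \<Rightarrow> nat set \<Rightarrow> 'k mpoly" where
  "koszul_d c S = (\<Sum>i\<in>S. koszul_sign i S * X i * c (S - {i}))"

text \<open>Contraction with the dual vector of \<open>e_k\<close>.\<close>

definition koszul_h :: "nat \<Rightarrow> (nat set \<Rightarrow> ('k::field) mpoly) \<Rightarrow> nat set \<Rightarrow> 'k mpoly" where
  "koszul_h k c S = (if k \<in> S then 0 else koszul_sign k S * c (insert k S))"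

lemma koszul_sign_remove:
  assumes "finite S" "i \<in> S"
  shows "koszul_sign k (S - {i}) = (if i < k then - koszul_sign k S else koszul_sign k S)"
proof (cases "i < k")
  case True
  have "{j \<in> S. j < k} = insert i {j \<in> S - {i}. j < k}" using True assms by auto
  then have "card {j \<in> S. j < k} = Suc (card {j \<in> S - {i}. j < k})" using assms by simp
  then show ?thesis using True by (simp add: koszul_sign_def)
next
  case False
  have "{j \<in> S. j < k} = {j \<in> S - {i}. j < k}" using False by auto
  then show ?thesis using False by (simp add: koszul_sign_def)
qed

lemma koszul_sign_square: "koszul_sign i S * koszul_sign i S = 1"
  by (cases "even (card {j \<in> S. j < i})") (auto simp: koszul_sign_def)

lemma koszul_sign_Pn: "koszul_sign i S \<in> Pn n"
  by (cases "even (card {j \<in> S. j < i})") (auto simp: koszul_sign_def Pn_uminus)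

text \<open>Removing \<open>i\<close> and then \<open>k\<close> gives the same cochain value as the
  opposite order, with the opposite sign. The ordered pairs are split into those with
  \<open>i < k\<close> and their mirror images, which cancel termwise.\<close>

lemma koszul_d_d:
  fixes c :: "nat set \<Rightarrow> ('k::field) mpoly"
  assumes fS: "finite S"
  shows "koszul_d (koszul_d c) S = 0"
proof -
  define F :: "nat \<times> nat \<Rightarrow> 'k mpoly" where "F \<equiv> \<lambda>(i, k).
    koszul_sign i S * X i * (koszul_sign k (S - {i}) * X k * c (S - {i} - {k}))"
  define U where "U = {(i, k). i \<in> S \<and> k \<in> S \<and> i < k}"
  have finU: "finite U" by (rule finite_subset[of _ "S \<times> S"]) (use fS in \<open>auto simp: U_def\<close>)
  have "koszul_d (koszul_d c) S = (\<Sum>i\<in>S. \<Sum>k\<in>S - {i}. F (i, k))"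
    by (simp add: koszul_d_def F_def sum_distrib_left)
  also have "\<dots> = sum F (SIGMA i:S. S - {i})"
    using fS by (subst sum.Sigma) auto
  also have "(SIGMA i:S. S - {i}) = U \<union> prod.swap ` U"
    by (force simp: U_def)
  also have "sum F \<dots> = sum F U + sum F (prod.swap ` U)"
    by (rule sum.union_disjoint) (use finU in \<open>auto simp: U_def\<close>)
  also have "sum F (prod.swap ` U) = (\<Sum>p\<in>U. F (prod.swap p))"
    by (subst sum.reindex) auto
  also have "sum F U + \<dots> = (\<Sum>p\<in>U. F p + F (prod.swap p))"
    by (simp add: sum.distrib)
  also have "\<dots> = 0"
  proof (rule sum.neutral, clarify)
    fix i k assume "(i, k) \<in> U"
    then have ik: "i \<in> S" "k \<in> S" "i < k" by (auto simp: U_def)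
    have "S - {k} - {i} = S - {i} - {k}" by auto
    then show "F (i, k) + F (prod.swap (i, k)) = 0"
      using ik koszul_sign_remove[OF fS ik(1), of k, where 'a='k]
        koszul_sign_remove[OF fS ik(2), of i, where 'a='k]
      by (simp add: F_def mult_ac)
  qed
  finally show ?thesis .
qed

text \<open>The Cartan formula: contraction is an antiderivation, so its anticommutator with
  multiplication by a vector is the value of the functional on that vector, here \<open>X k\<close>.
  If \<open>k\<close> is in \<open>S\<close>, only the summand \<open>i = k\<close> survives;
  otherwise everything cancels except the summand of \<open>k\<close> in the differential over
  \<open>insert k S\<close>.\<close>

lemma koszul_d_h:
  fixes c :: "nat set \<Rightarrow> ('k::field) mpoly"
  assumes fS: "finite S"
  shows "koszul_d (koszul_h k c) S + koszul_h k (koszul_d c) S = X k * c S"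
proof (cases "k \<in> S")
  case True
  have "koszul_d (koszul_h k c) S = (\<Sum>i\<in>S. if i = k then X k * c S else 0)"
    unfolding koszul_d_def
  proof (rule sum.cong[OF refl])
    fix i assume "i \<in> S"
    have "koszul_sign k S * X k * (koszul_sign k S * c S) = X k * c S"
    proof -
      have "koszul_sign k S * X k * (koszul_sign k S * c S) =
          (koszul_sign k S * koszul_sign k S) * (X k * c S)" by (simp only: mult_ac)
      then show ?thesis by (simp add: koszul_sign_square)
    qed
    then show "koszul_sign i S * X i * koszul_h k c (S - {i}) = (if i = k then X k * c S else 0)"
      using True koszul_sign_remove[OF fS True, of k, where 'a='k]
      by (auto simp: koszul_h_def insert_absorb)
  qed
  also have "\<dots> = X k * c S" using True fS by simp
  finally show ?thesis using True by (simp add: koszul_h_def)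
next
  case False
  let ?T = "insert k S"
  have "koszul_h k (koszul_d c) S = koszul_sign k S * (koszul_sign k ?T * X k * c S +
      (\<Sum>i\<in>S. koszul_sign i ?T * X i * c (?T - {i})))"
    using False fS by (simp add: koszul_h_def koszul_d_def)
  also have "koszul_sign k ?T = (koszul_sign k S :: 'k mpoly)"
    using koszul_sign_remove[of ?T k k, where 'a='k] fS False by simp
  also have "koszul_sign k S * (koszul_sign k S * X k * c S +
      (\<Sum>i\<in>S. koszul_sign i ?T * X i * c (?T - {i})))
     = (koszul_sign k S * koszul_sign k S) * X k * c S +
      (\<Sum>i\<in>S. koszul_sign k S * (koszul_sign i ?T * X i * c (?T - {i})))"
    by (simp add: distrib_left sum_distrib_left mult.assoc)
  also have "\<dots> = X k * c S + (\<Sum>i\<in>S. koszul_sign k S * (koszul_sign i ?T * X i * c (?T - {i})))"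
    by (simp add: koszul_sign_square)
  finally have 1: "koszul_h k (koszul_d c) S =
    X k * c S + (\<Sum>i\<in>S. koszul_sign k S * (koszul_sign i ?T * X i * c (?T - {i})))" .
  have "koszul_d (koszul_h k c) S = (\<Sum>i\<in>S. - (koszul_sign k S * (koszul_sign i ?T * X i * c (?T - {i}))))"
    unfolding koszul_d_def
  proof (rule sum.cong[OF refl])
    fix i assume i: "i \<in> S"
    have ik: "i \<noteq> k" using i False by auto
    have T: "insert k (S - {i}) = ?T - {i}" using ik by auto
    have s1: "koszul_sign k (S - {i}) = (if i < k then - koszul_sign k S else koszul_sign k S :: 'k mpoly)"
      by (rule koszul_sign_remove[OF fS i])
    have s2: "koszul_sign i S = (if k < i then - koszul_sign i ?T else koszul_sign i ?T :: 'k mpoly)"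
      using koszul_sign_remove[of ?T k i, where 'a='k] fS False by simp
    show "koszul_sign i S * X i * koszul_h k c (S - {i})
      = - (koszul_sign k S * (koszul_sign i ?T * X i * c (?T - {i})))"
    proof -
      have "koszul_h k c (S - {i}) = koszul_sign k (S - {i}) * c (?T - {i})"
        using False by (simp add: koszul_h_def flip: T)
      moreover have "koszul_sign i S * koszul_sign k (S - {i}) = - (koszul_sign k S * koszul_sign i ?T :: 'k mpoly)"
        using ik unfolding s1 s2 by (cases "i < k") (simp_all add: mult.commute)
      moreover have "koszul_sign i S * X i * (koszul_sign k (S - {i}) * c (?T - {i})) =
          (koszul_sign i S * koszul_sign k (S - {i})) * (X i * c (?T - {i}))"
        by (simp only: mult_ac)
      ultimately show ?thesis by (simp only: mult_minus_left mult.assoc)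
    qed
  qed
  then show ?thesis using 1 by (simp add: sum_negf)
qed

lemma koszul_d_add: "koszul_d (\<lambda>S. a S + b S) S = koszul_d a S + koszul_d b S"
  by (simp add: koszul_d_def distrib_left sum.distrib)

lemma koszul_d_scale: "koszul_d (\<lambda>S. r * a S) S = r * koszul_d a S"
  by (simp add: koszul_d_def sum_distrib_left mult_ac)

lemma koszul_d_diff: "koszul_d (\<lambda>S. a S - b S) S = koszul_d a S - koszul_d b S"
  by (simp add: koszul_d_def right_diff_distrib sum_subtractf)

lemma koszul_d_sum: "koszul_d (\<lambda>S. \<Sum>k\<in>A. a k S) S = (\<Sum>k\<in>A. koszul_d (a k) S)"
  unfolding koszul_d_def sum_distrib_left by (rule sum.swap)

lemma koszul_d_cong: "(\<And>i. i \<in> S \<Longrightarrow> a (S - {i}) = b (S - {i})) \<Longrightarrow> koszul_d a S = koszul_d b S"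
  by (simp add: koszul_d_def)

lemma koszul_d_in_ideal:
  assumes "is_ideal n A" "S \<subseteq> {..<n}" "\<And>i. i \<in> S \<Longrightarrow> c (S - {i}) \<in> A"
  shows "koszul_d c S \<in> A"
  unfolding koszul_d_def
  by (rule is_ideal_sum[OF assms(1)], rule is_ideal_mult[OF assms(1)])
     (use assms in \<open>auto intro!: Pn_mult koszul_sign_Pn Pn_X\<close>)

lemma is_ideal_Pn: "is_ideal n (Pn n)"
  by (rule is_idealI) (auto intro: Pn_add Pn_mult)

lemma max_ideal_decomp:
  fixes f :: "('k::field) mpoly"
  assumes "f \<in> max_ideal n"
  obtains r where "\<And>k. r k \<in> Pn n" "f = (\<Sum>k<n. r k * X k)"
proof -
  define M :: "'k mpoly set" where
    "M = {f. \<exists>r. (\<forall>k. r k \<in> Pn n) \<and> f = (\<Sum>k<n. r k * X k)}"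
  have "is_ideal n M"
  proof (rule is_idealI)
    show "M \<subseteq> Pn n" by (auto simp: M_def intro!: Pn_sum Pn_mult Pn_X)
    show "0 \<in> M" by (auto simp: M_def intro!: exI[of _ "\<lambda>_. 0"])
    fix a b :: "'k mpoly" assume "a \<in> M" "b \<in> M"
    then obtain p q where "\<And>k. p k \<in> Pn n" "a = (\<Sum>k<n. p k * X k)"
      "\<And>k. q k \<in> Pn n" "b = (\<Sum>k<n. q k * X k)" by (auto simp: M_def)
    then show "a + b \<in> M"
      by (auto simp: M_def distrib_right sum.distrib Pn_add intro!: exI[of _ "\<lambda>k. p k + q k"])
  next
    fix r a :: "'k mpoly" assume r: "r \<in> Pn n" and "a \<in> M"
    then obtain p where "\<And>k. p k \<in> Pn n" "a = (\<Sum>k<n. p k * X k)" by (auto simp: M_def)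
    then show "r * a \<in> M"
      using r by (auto simp: M_def sum_distrib_left Pn_mult mult.assoc intro!: exI[of _ "\<lambda>k. r * p k"])
  qed
  moreover have "single m c \<in> M" if m: "m \<noteq> 0" "keys m \<subseteq> {..<n}" for m and c :: 'k
  proof -
    obtain i where i: "i \<in> keys m" using m(1) by (metis ex_in_conv keys_eq_empty)
    obtain m' where m': "m = m' + single i 1" "keys m' \<subseteq> keys m" using exponent_split[OF i] by metis
    have "i < n" using i m by auto
    have "(\<Sum>k<n. (if k = i then single m' c else 0) * X k) =
        (\<Sum>k<n. if k = i then single m' c * X k else 0)"
      by (rule sum.cong) auto
    also have "\<dots> = single m c" using \<open>i < n\<close> m' by (simp add: X_def mult_single)
    finally show ?thesis
      using m m' by (auto simp: M_def Pn_single intro!: exI[of _ "\<lambda>k. if k = i then single m' c else 0"])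
  qed
  ultimately have "mon_ideal n (\<lambda>m. m \<noteq> 0) \<subseteq> M" by (rule mon_ideal_subsetI) auto
  moreover have "f \<in> mon_ideal n (\<lambda>m. m \<noteq> 0)"
    using assms by (auto simp: max_ideal_def mon_ideal_def in_keys_iff)
  ultimately show ?thesis using that by (auto simp: M_def)
qed

text \<open>Writing \<open>f\<close> as a combination of the variables with coefficients
  \<open>r k\<close>, the same combination of the contractions is a null-homotopy of multiplication
  by \<open>f\<close>. The second property lets it descend modulo an ideal; \<open>A\<close> is left
  arbitrary because it is needed both for the ideal under study and for \<open>Pn n\<close>.\<close>

lemma koszul_homotopy:
  fixes f :: "('k::field) mpoly"
  assumes "f \<in> max_ideal n"
  obtains h where
    "\<And>c S. finite S \<Longrightarrow> koszul_d (h c) S + h (koszul_d c) S = f * c S"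
    "\<And>c S A. is_ideal n A \<Longrightarrow> (\<And>k. k < n \<Longrightarrow> k \<notin> S \<Longrightarrow> c (insert k S) \<in> A) \<Longrightarrow> h c S \<in> A"
proof -
  obtain r where r: "\<And>k. r k \<in> Pn n" "f = (\<Sum>k<n. r k * X k)"
    by (rule max_ideal_decomp[OF assms]) blast
  define h where "h \<equiv> \<lambda>c S. \<Sum>k<n. r k * koszul_h k c S"
  show thesis
  proof
    fix c :: "nat set \<Rightarrow> 'k mpoly" and S :: "nat set" assume S: "finite S"
    have "koszul_d (h c) S + h (koszul_d c) S =
      (\<Sum>k<n. r k * (koszul_d (koszul_h k c) S + koszul_h k (koszul_d c) S))"
      by (simp add: h_def koszul_d_sum koszul_d_scale sum.distrib distrib_left)
    then show "koszul_d (h c) S + h (koszul_d c) S = f * c S"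
      by (simp add: koszul_d_h[OF S] r(2) sum_distrib_right mult.assoc)
  next
    fix c :: "nat set \<Rightarrow> 'k mpoly" and S :: "nat set" and A
    assume A: "is_ideal n A" "\<And>k. k < n \<Longrightarrow> k \<notin> S \<Longrightarrow> c (insert k S) \<in> A"
    show "h c S \<in> A"
      unfolding h_def koszul_h_def
      by (rule is_ideal_sum[OF A(1)], rule is_ideal_mult[OF A(1) r(1)])
         (auto intro: is_ideal_0[OF A(1)] is_ideal_mult[OF A(1) koszul_sign_Pn] A(2))
  qed
qed

text \<open>Nonvanishing of the \<open>p\<close>-th Koszul cohomology of \<open>R/J\<close> for the
  variables, phrased with lifts to \<open>R\<close> so that no quotient ring has to be formed. For
  \<open>p = 0\<close> the coboundary at \<open>{}\<close> is an empty sum, so the condition says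
  that \<open>R/J\<close> has a nonzero socle.\<close>

definition koszul_nonzero :: "nat \<Rightarrow> ('k::field) mpoly set \<Rightarrow> nat \<Rightarrow> bool" where
  "koszul_nonzero n J p \<longleftrightarrow> (\<exists>c. (\<forall>S. c S \<in> Pn n) \<and>
     (\<forall>S. S \<subseteq> {..<n} \<and> card S = Suc p \<longrightarrow> koszul_d c S \<in> J) \<and>
     \<not> (\<exists>b. (\<forall>S. b S \<in> Pn n) \<and> (\<forall>S. S \<subseteq> {..<n} \<and> card S = p \<longrightarrow> c S - koszul_d b S \<in> J)))"

lemma ideal_gen_insert:
  fixes f :: "('k::field) mpoly"
  assumes J: "is_ideal n J" and f: "f \<in> Pn n"
  shows "ideal_gen n (J \<union> {f}) = {a + f * g | a g. a \<in> J \<and> g \<in> Pn n}" (is "_ = ?R")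
proof
  have "is_ideal n ?R"
  proof (rule is_idealI)
    show "?R \<subseteq> Pn n" using is_ideal_subset[OF J] f by (auto intro!: Pn_add Pn_mult)
    show "0 \<in> ?R" using is_ideal_0[OF J] by (force intro: exI[of _ 0])
    fix a b :: "'k mpoly" assume "a \<in> ?R" "b \<in> ?R"
    then obtain a1 g1 a2 g2 where "a = a1 + f * g1" "b = a2 + f * g2"
      "a1 \<in> J" "g1 \<in> Pn n" "a2 \<in> J" "g2 \<in> Pn n" by auto
    moreover from this have "a + b = (a1 + a2) + f * (g1 + g2)" by (simp add: algebra_simps)
    ultimately show "a + b \<in> ?R" using is_ideal_add[OF J] Pn_add by blast
  next
    fix r a :: "'k mpoly" assume r: "r \<in> Pn n" and "a \<in> ?R"
    then obtain a1 g1 where "a = a1 + f * g1" "a1 \<in> J" "g1 \<in> Pn n" by auto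
    moreover from this have "r * a = r * a1 + f * (r * g1)" by (simp add: algebra_simps)
    ultimately show "r * a \<in> ?R" using is_ideal_mult[OF J r] Pn_mult[OF r] by blast
  qed
  moreover have "J \<union> {f} \<subseteq> ?R"
    using is_ideal_0[OF J] by (force intro: exI[of _ 0] exI[of _ 1])
  ultimately show "ideal_gen n (J \<union> {f}) \<subseteq> ?R" by (rule ideal_gen_least)
  have "a + f * g \<in> ideal_gen n (J \<union> {f})" if "a \<in> J" "g \<in> Pn n" for a g
  proof -
    have "g * f \<in> ideal_gen n (J \<union> {f})" using that by (intro ideal_gen.mult ideal_gen.gen) auto
    moreover have "a \<in> ideal_gen n (J \<union> {f})" using that by (intro ideal_gen.gen) auto
    ultimately show ?thesis by (metis ideal_gen.add mult.commute)
  qed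
  then show "?R \<subseteq> ideal_gen n (J \<union> {f})" by auto
qed

text \<open>The next two lemmas are the long exact Koszul sequence of \<open>0 \<rightarrow> R/J \<rightarrow> R/J \<rightarrow> R/(J + f) \<rightarrow> 0\<close>;
  multiplication by \<open>f\<close> is null-homotopic, so it splits into short exact pieces.\<close>

lemma koszul_nonzero_descend:
  fixes f :: "('k::field) mpoly"
  assumes J: "is_ideal n J" and f: "f \<in> max_ideal n"
    and reg: "\<And>g. g \<in> Pn n \<Longrightarrow> f * g \<in> J \<Longrightarrow> g \<in> J"
    and nz: "koszul_nonzero n J (Suc p)"
  shows "koszul_nonzero n (ideal_gen n (J \<union> {f})) p"
proof -
  have fP: "f \<in> Pn n" using f by (simp add: max_ideal_def)
  obtain c where c: "\<And>S. c S \<in> Pn n"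
    "\<And>S. S \<subseteq> {..<n} \<Longrightarrow> card S = Suc (Suc p) \<Longrightarrow> koszul_d c S \<in> J"
    and nb: "\<nexists>b. (\<forall>S. b S \<in> Pn n) \<and> (\<forall>S. S \<subseteq> {..<n} \<and> card S = Suc p \<longrightarrow> c S - koszul_d b S \<in> J)"
    using nz by (auto simp: koszul_nonzero_def)
  obtain h where h: "\<And>c S. finite S \<Longrightarrow> koszul_d (h c) S + h (koszul_d c) S = f * c S"
    "\<And>c S A. is_ideal n A \<Longrightarrow> (\<And>k. k < n \<Longrightarrow> k \<notin> S \<Longrightarrow> c (insert k S) \<in> A) \<Longrightarrow> h c S \<in> A"
    by (rule koszul_homotopy[OF f]) blast
  have de: "h (koszul_d c) S \<in> J" if S: "S \<subseteq> {..<n}" "card S = Suc p" for S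
  proof (rule h(2)[OF J])
    fix k assume "k < n" "k \<notin> S"
    then show "koszul_d c (insert k S) \<in> J"
      using S finite_subset[OF S(1)] by (intro c(2)) auto
  qed
  have fin: "finite S" if "S \<subseteq> {..<n}" for S :: "nat set" using that finite_subset by blast
  show ?thesis
    unfolding koszul_nonzero_def
  \<comment> \<open>Modulo \<open>J\<close> the homotopy gives
    \<open>koszul_d (h c) = f * c\<close>. So \<open>h c\<close> is a cocycle modulo
    \<open>J + f\<close>, and the connecting map sends its class to that of
    \<open>c\<close>.\<close>
  proof (intro exI[of _ "h c"] conjI allI impI notI)
    show "h c S \<in> Pn n" for S by (rule h(2)[OF is_ideal_Pn]) (rule c(1))
  next
    fix S assume S: "S \<subseteq> {..<n} \<and> card S = Suc p"
    have "koszul_d (h c) S = - h (koszul_d c) S + f * c S"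
      using h(1)[OF fin, of S c] S by (simp add: algebra_simps)
    moreover have "- h (koszul_d c) S \<in> J" using is_ideal_uminus[OF J de] S by blast
    ultimately show "koszul_d (h c) S \<in> ideal_gen n (J \<union> {f})"
      unfolding ideal_gen_insert[OF J fP] using c(1) by blast
  next
    assume "\<exists>b. (\<forall>S. b S \<in> Pn n) \<and>
      (\<forall>S. S \<subseteq> {..<n} \<and> card S = p \<longrightarrow> h c S - koszul_d b S \<in> ideal_gen n (J \<union> {f}))"
    then obtain b where b: "\<And>S. b S \<in> Pn n"
      "\<And>S. S \<subseteq> {..<n} \<Longrightarrow> card S = p \<Longrightarrow> \<exists>j a. h c S - koszul_d b S = j + f * a \<and> j \<in> J \<and> a \<in> Pn n"
      unfolding ideal_gen_insert[OF J fP] by blast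
    then obtain j a where ja: "\<And>S. S \<subseteq> {..<n} \<Longrightarrow> card S = p \<Longrightarrow>
       h c S - koszul_d b S = j S + f * a S \<and> j S \<in> J \<and> a S \<in> Pn n" by metis
    \<comment> \<open>The choice \<open>a\<close> is controlled only on sets of size
      \<open>p\<close> inside \<open>{..<n}\<close>; the default value zero makes it a cochain over
      \<open>Pn n\<close>. Cancelling \<open>f\<close> then shows that \<open>c\<close> is the
      coboundary of \<open>a'\<close> modulo \<open>J\<close>.\<close>
    define a' where "a' S = (if S \<subseteq> {..<n} \<and> card S = p then a S else 0)" for S
    have a': "a' S \<in> Pn n" for S using ja by (simp add: a'_def)
    have "c S - koszul_d a' S \<in> J" if S: "S \<subseteq> {..<n}" "card S = Suc p" for S
    proof (rule reg)
      show "c S - koszul_d a' S \<in> Pn n"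
        using S a' c(1) by (intro Pn_diff koszul_d_in_ideal[OF is_ideal_Pn])
      have fS: "finite S" using S fin by auto
      have sub: "S - {i} \<subseteq> {..<n}" "card (S - {i}) = p" if "i \<in> S" for i
        using S that fS by auto
      have "koszul_d (h c) S = koszul_d (\<lambda>S. koszul_d b S + (j S + f * a' S)) S"
      proof (rule koszul_d_cong)
        fix i assume "i \<in> S"
        then show "h c (S - {i}) = koszul_d b (S - {i}) + (j (S - {i}) + f * a' (S - {i}))"
          using ja[OF sub] sub[of i] by (simp add: a'_def algebra_simps)
      qed
      also have "\<dots> = koszul_d j S + f * koszul_d a' S"
        by (simp add: koszul_d_add koszul_d_scale koszul_d_d[OF fS])
      finally have "f * (c S - koszul_d a' S) = koszul_d j S + h (koszul_d c) S"
        using h(1)[OF fS, of c] by (simp add: algebra_simps)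
      moreover have "koszul_d j S \<in> J"
        using S(1) ja sub by (intro koszul_d_in_ideal[OF J]) auto
      ultimately show "f * (c S - koszul_d a' S) \<in> J"
        using de[OF S] is_ideal_add[OF J] by simp
    qed
    then show False using nb a' by blast
  qed
qed

lemma koszul_nonzero_ascend:
  fixes f :: "('k::field) mpoly"
  assumes J: "is_ideal n J" and fP: "f \<in> Pn n"
    and reg: "\<And>g. g \<in> Pn n \<Longrightarrow> f * g \<in> J \<Longrightarrow> g \<in> J"
    and nz: "koszul_nonzero n (ideal_gen n (J \<union> {f})) p" and z: "\<not> koszul_nonzero n J p"
  shows "koszul_nonzero n J (Suc p)"
proof -
  obtain e where e: "\<And>S. e S \<in> Pn n"
    "\<And>S. S \<subseteq> {..<n} \<Longrightarrow> card S = Suc p \<Longrightarrow> koszul_d e S \<in> ideal_gen n (J \<union> {f})"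
    and nb: "\<nexists>b. (\<forall>S. b S \<in> Pn n) \<and>
      (\<forall>S. S \<subseteq> {..<n} \<and> card S = p \<longrightarrow> e S - koszul_d b S \<in> ideal_gen n (J \<union> {f}))"
    using nz by (auto simp: koszul_nonzero_def)
  have fin: "finite S" if "S \<subseteq> {..<n}" for S :: "nat set" using that finite_subset by blast
  have "\<And>S. S \<subseteq> {..<n} \<Longrightarrow> card S = Suc p \<Longrightarrow> \<exists>j c. koszul_d e S = j + f * c \<and> j \<in> J \<and> c \<in> Pn n"
    using e(2) unfolding ideal_gen_insert[OF J fP] by blast
  then obtain j c where jc: "\<And>S. S \<subseteq> {..<n} \<Longrightarrow> card S = Suc p \<Longrightarrow>
       koszul_d e S = j S + f * c S \<and> j S \<in> J \<and> c S \<in> Pn n" by metis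
  define c' where "c' S = (if S \<subseteq> {..<n} \<and> card S = Suc p then c S else 0)" for S
  have c': "c' S \<in> Pn n" for S using jc by (simp add: c'_def)
  show ?thesis
    unfolding koszul_nonzero_def
  \<comment> \<open>The class of \<open>c'\<close> is the image of that of \<open>e\<close> under
    the connecting map: lift \<open>e\<close>, apply the differential, divide by
    \<open>f\<close>.\<close>
  proof (intro exI[of _ c'] conjI allI impI notI)
    show "c' S \<in> Pn n" for S by (rule c')
  next
    fix S assume S: "S \<subseteq> {..<n} \<and> card S = Suc (Suc p)"
    then have fS: "finite S" using fin by auto
    have sub: "S - {i} \<subseteq> {..<n}" "card (S - {i}) = Suc p" if "i \<in> S" for i
      using S that fS by auto
    show "koszul_d c' S \<in> J"
    proof (rule reg)
      show "koszul_d c' S \<in> Pn n" using S c' by (intro koszul_d_in_ideal[OF is_ideal_Pn]) auto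
      have "koszul_d (koszul_d e) S = koszul_d (\<lambda>S. j S + f * c' S) S"
        by (rule koszul_d_cong) (use jc sub in \<open>auto simp: c'_def\<close>)
      then have "koszul_d j S + f * koszul_d c' S = 0"
        by (simp add: koszul_d_d[OF fS] koszul_d_add koszul_d_scale)
      then have "f * koszul_d c' S = - koszul_d j S" by (metis minus_unique)
      moreover have "koszul_d j S \<in> J"
        using S jc sub by (intro koszul_d_in_ideal[OF J]) auto
      ultimately show "f * koszul_d c' S \<in> J" using is_ideal_uminus[OF J] by simp
    qed
  next
    assume "\<exists>b. (\<forall>S. b S \<in> Pn n) \<and> (\<forall>S. S \<subseteq> {..<n} \<and> card S = Suc p \<longrightarrow> c' S - koszul_d b S \<in> J)"
    then obtain a where a: "\<And>S. a S \<in> Pn n"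
      "\<And>S. S \<subseteq> {..<n} \<Longrightarrow> card S = Suc p \<Longrightarrow> c' S - koszul_d a S \<in> J" by auto
    \<comment> \<open>If \<open>c'\<close> were the coboundary of \<open>a\<close> modulo
      \<open>J\<close>, then \<open>e - f * a\<close> would be a cocycle modulo \<open>J\<close>. By
      the vanishing assumption \<open>z\<close> it would be a coboundary there, hence
      \<open>e\<close> would be one modulo \<open>J + f\<close>.\<close>
    have cyc: "koszul_d (\<lambda>S. e S - f * a S) S \<in> J" if S: "S \<subseteq> {..<n}" "card S = Suc p" for S
    proof -
      have "koszul_d (\<lambda>S. e S - f * a S) S = j S + f * (c' S - koszul_d a S)"
        using jc[OF S] S by (simp add: koszul_d_diff koszul_d_scale c'_def algebra_simps)
      then show ?thesis
        using jc[OF S] a(2)[OF S] is_ideal_add[OF J] is_ideal_mult[OF J fP] by simp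
    qed
    have inP: "e S - f * a S \<in> Pn n" for S
      using e(1) a(1) fP by (intro Pn_diff Pn_mult)
    have "\<exists>b. (\<forall>S. b S \<in> Pn n) \<and>
        (\<forall>S. S \<subseteq> {..<n} \<and> card S = p \<longrightarrow> e S - f * a S - koszul_d b S \<in> J)"
    proof (rule ccontr)
      assume no: "\<not> ?thesis"
      have "koszul_nonzero n J p"
        unfolding koszul_nonzero_def
      proof (intro exI[of _ "\<lambda>S. e S - f * a S"] conjI)
        show "\<forall>S. e S - f * a S \<in> Pn n" using inP by simp
        show "\<forall>S. S \<subseteq> {..<n} \<and> card S = Suc p \<longrightarrow> koszul_d (\<lambda>S. e S - f * a S) S \<in> J"
          using cyc by simp
      qed (rule no)
      then show False using z by simp
    qed
    then obtain b where b: "\<And>S. b S \<in> Pn n"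
      "\<And>S. S \<subseteq> {..<n} \<Longrightarrow> card S = p \<Longrightarrow> e S - f * a S - koszul_d b S \<in> J" by blast
    have "e S - koszul_d b S \<in> ideal_gen n (J \<union> {f})" if S: "S \<subseteq> {..<n}" "card S = p" for S
    proof -
      have "e S - koszul_d b S = (e S - f * a S - koszul_d b S) + f * a S" by simp
      then show ?thesis
        unfolding ideal_gen_insert[OF J fP] using b(2)[OF S] a(1)[of S] by blast
    qed
    then show False using nb b(1) by blast
  qed
qed

section \<open>Koszul cohomology along a regular sequence\<close>

lemma ideal_gen_mono: "G \<subseteq> H \<Longrightarrow> ideal_gen n G \<subseteq> ideal_gen n H"
proof
  fix x assume "G \<subseteq> H" "x \<in> ideal_gen n G"
  show "x \<in> ideal_gen n H"
    using \<open>x \<in> ideal_gen n G\<close> by induction (use \<open>G \<subseteq> H\<close> in \<open>auto intro: ideal_gen.intros\<close>)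
qed

lemma ideal_gen_Un:
  assumes "A \<subseteq> Pn n" "B \<subseteq> Pn n"
  shows "ideal_gen n (ideal_gen n A \<union> B) = ideal_gen n (A \<union> B)"
proof
  show "ideal_gen n (ideal_gen n A \<union> B) \<subseteq> ideal_gen n (A \<union> B)"
    using assms ideal_gen_mono[of A "A \<union> B" n]
    by (intro ideal_gen_least is_ideal_ideal_gen) (auto intro: ideal_gen.gen)
  show "ideal_gen n (A \<union> B) \<subseteq> ideal_gen n (ideal_gen n A \<union> B)"
    by (rule ideal_gen_mono) (auto intro: ideal_gen.gen)
qed

lemma ideal_gen_ideal: "is_ideal n J \<Longrightarrow> ideal_gen n J = J"
  by (simp add: is_ideal_def)

lemma regular_seq_ConsD:
  fixes f :: "('k::field) mpoly"
  assumes J: "is_ideal n J" and reg: "regular_seq n J (f # fs)"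
  shows "f \<in> max_ideal n" "\<And>g. g \<in> Pn n \<Longrightarrow> f * g \<in> J \<Longrightarrow> g \<in> J"
    "regular_seq n (ideal_gen n (J \<union> {f})) fs"
    "ideal_gen n (ideal_gen n (J \<union> {f}) \<union> set fs) = ideal_gen n (J \<union> set (f # fs))"
proof -
  note r = reg[unfolded regular_seq_def]
  show "f \<in> max_ideal n" using r by auto
  show "g \<in> J" if "g \<in> Pn n" "f * g \<in> J" for g
    using conjunct1[OF conjunct2[OF r], rule_format, of 0 g] that by (simp add: ideal_gen_ideal[OF J])
  have sub: "J \<union> {f} \<subseteq> Pn n" "set fs \<subseteq> Pn n"
    using r is_ideal_subset[OF J] by (auto simp: max_ideal_def)
  have eq: "ideal_gen n (ideal_gen n (J \<union> {f}) \<union> B) = ideal_gen n (J \<union> insert f B)"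
    if "B \<subseteq> set fs" for B
  proof -
    have "J \<union> {f} \<union> B = J \<union> insert f B" by auto
    then show ?thesis using ideal_gen_Un[OF sub(1), of B] that sub(2) by simp
  qed
  show "regular_seq n (ideal_gen n (J \<union> {f})) fs"
    unfolding regular_seq_def
  proof (intro conjI allI impI ballI)
    show "set fs \<subseteq> max_ideal n" using r by auto
    show "ideal_gen n (ideal_gen n (J \<union> {f}) \<union> set fs) \<noteq> Pn n" using r eq[of "set fs"] by simp
    fix i g assume i: "i < length fs" "g \<in> Pn n"
      "fs ! i * g \<in> ideal_gen n (ideal_gen n (J \<union> {f}) \<union> set (take i fs))"
    then show "g \<in> ideal_gen n (ideal_gen n (J \<union> {f}) \<union> set (take i fs))"
      using conjunct1[OF conjunct2[OF r], rule_format, of "Suc i" g] eq[OF set_take_subset, of i] by simp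
  qed
  show "ideal_gen n (ideal_gen n (J \<union> {f}) \<union> set fs) = ideal_gen n (J \<union> set (f # fs))"
    using eq[of "set fs"] by simp
qed

text \<open>Dividing by the head of the sequence lowers the degree of a nonzero class by one while
  shortening the sequence by one. In degree 0 a cocycle is annihilated by all variables, hence by
  \<open>f\<close>, and regularity of \<open>f\<close> puts it into \<open>J\<close>.\<close>

lemma regular_seq_koszul_zero:
  fixes J :: "('k::field) mpoly set"
  assumes "is_ideal n J" "regular_seq n J fs" "p < length fs"
  shows "\<not> koszul_nonzero n J p"
  using assms
proof (induction fs arbitrary: J p)
  case (Cons f fs)
  note r = regular_seq_ConsD[OF Cons.prems(1,2)]
  have J': "is_ideal n (ideal_gen n (J \<union> {f}))"
    using is_ideal_subset[OF Cons.prems(1)] r(1) by (intro is_ideal_ideal_gen) (auto simp: max_ideal_def)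
  show ?case
  proof (cases p)
    case 0
    obtain h where h: "\<And>c S. finite S \<Longrightarrow> koszul_d (h c) S + h (koszul_d c) S = f * c S"
      "\<And>c S A. is_ideal n A \<Longrightarrow> (\<And>k. k < n \<Longrightarrow> k \<notin> S \<Longrightarrow> c (insert k S) \<in> A) \<Longrightarrow> h c S \<in> A"
      by (rule koszul_homotopy[OF r(1)]) blast
    show ?thesis
    proof
      assume "koszul_nonzero n J p"
      then obtain c where c: "\<And>S. c S \<in> Pn n"
        "\<And>S. S \<subseteq> {..<n} \<Longrightarrow> card S = Suc 0 \<Longrightarrow> koszul_d c S \<in> J"
        and nb: "\<nexists>b. (\<forall>S. b S \<in> Pn n) \<and> (\<forall>S. S \<subseteq> {..<n} \<and> card S = 0 \<longrightarrow> c S - koszul_d b S \<in> J)"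
        using 0 by (auto simp: koszul_nonzero_def)
      have "h (koszul_d c) {} \<in> J"
        by (rule h(2)[OF Cons.prems(1)], rule c(2)) auto
      then have "f * c {} \<in> J" using h(1)[of "{}" c] by (simp add: koszul_d_def)
      then have "c {} \<in> J" using r(2) c(1) by blast
      have "c S - koszul_d (\<lambda>_. 0) S \<in> J" if "S \<subseteq> {..<n}" "card S = 0" for S
        using \<open>c {} \<in> J\<close> finite_subset[OF that(1)] that(2) by (simp add: koszul_d_def)
      then show False using nb by (auto dest: spec[of _ "\<lambda>_. 0"])
    qed
  next
    case (Suc q)
    then have "\<not> koszul_nonzero n (ideal_gen n (J \<union> {f})) q"
      using Cons.IH[OF J' r(3), of q] Cons.prems(3) by simp
    then show ?thesis using koszul_nonzero_descend[OF Cons.prems(1) r(1,2)] Suc by blast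
  qed
qed simp

text \<open>A socle class of the last quotient climbs one degree for each element removed from the
  sequence. The vanishing needed at each climb comes from \<open>regular_seq_koszul_zero\<close>, as
  the current degree is below the length of the sequence.\<close>

lemma regular_seq_koszul_nonzero:
  fixes J :: "('k::field) mpoly set"
  assumes "is_ideal n J" "regular_seq n J fs" "koszul_nonzero n (ideal_gen n (J \<union> set fs)) 0"
  shows "koszul_nonzero n J (length fs)"
  using assms
proof (induction fs arbitrary: J)
  case Nil
  then show ?case by (simp add: ideal_gen_ideal)
next
  case (Cons f fs)
  note r = regular_seq_ConsD[OF Cons.prems(1,2)]
  have fP: "f \<in> Pn n" using r(1) by (simp add: max_ideal_def)
  have J': "is_ideal n (ideal_gen n (J \<union> {f}))"
    using is_ideal_subset[OF Cons.prems(1)] fP by (intro is_ideal_ideal_gen) auto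
  have "koszul_nonzero n (ideal_gen n (J \<union> {f})) (length fs)"
    using Cons.IH[OF J' r(3)] Cons.prems(3) r(4) by simp
  moreover have "\<not> koszul_nonzero n J (length fs)"
    by (rule regular_seq_koszul_zero[OF Cons.prems(1,2)]) simp
  ultimately show ?case using koszul_nonzero_ascend[OF Cons.prems(1) fP r(2)] by simp
qed

lemma regular_seq_le_depth: "regular_seq n J fs \<Longrightarrow> enat (length fs) \<le> depth n J"
  unfolding depth_def by (rule Sup_upper) auto

text \<open>The socle element \<open>u\<close> yields a nonzero class of degree
  \<open>length fs\<close> over \<open>R/J\<close>, and any longer regular sequence would force the
  cohomology in that degree to vanish. The constant cochain suffices in degree 0, where only the
  value at \<open>{}\<close> counts.\<close>

lemma depth_eq_length:
  fixes J :: "('k::field) mpoly set"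
  assumes J: "is_ideal n J" and reg: "regular_seq n J fs"
    and u: "u \<in> Pn n" "u \<notin> ideal_gen n (J \<union> set fs)"
    and socle: "\<And>i. i < n \<Longrightarrow> X i * u \<in> ideal_gen n (J \<union> set fs)"
  shows "depth n J = enat (length fs)"
proof (rule antisym)
  have "koszul_nonzero n (ideal_gen n (J \<union> set fs)) 0"
    unfolding koszul_nonzero_def
  proof (intro exI[of _ "\<lambda>_. u"] conjI allI impI notI)
    fix S :: "nat set" assume "S \<subseteq> {..<n} \<and> card S = Suc 0"
    then obtain i where "S = {i}" "i < n" by (auto simp: card_Suc_eq)
    moreover have "{j \<in> {i}. j < i} = {}" by auto
    then have "koszul_sign i {i} = (1 :: 'k mpoly)" by (simp only: koszul_sign_def card.empty power_0)
    ultimately show "koszul_d (\<lambda>_. u) S \<in> ideal_gen n (J \<union> set fs)"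
      using socle by (simp add: koszul_d_def)
  next
    assume "\<exists>b. (\<forall>S. b S \<in> Pn n) \<and>
      (\<forall>S. S \<subseteq> {..<n} \<and> card S = 0 \<longrightarrow> u - koszul_d b S \<in> ideal_gen n (J \<union> set fs))"
    then obtain b where "u - koszul_d b {} \<in> ideal_gen n (J \<union> set fs)" by auto
    then show False using u(2) by (simp add: koszul_d_def)
  qed (rule u(1))
  then have "koszul_nonzero n J (length fs)"
    by (rule regular_seq_koszul_nonzero[OF J reg])
  then have "length gs \<le> length fs" if "regular_seq n J gs" for gs
    using regular_seq_koszul_zero[OF J that] by (meson not_le)
  then show "depth n J \<le> enat (length fs)"
    unfolding depth_def by (intro Sup_least) auto
qed (rule regular_seq_le_depth[OF reg])

section \<open>Blocks and transversals\<close>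

text \<open>Used on two levels: along a map of variables it acts on exponent vectors, and along the
  resulting map of exponent vectors it acts on polynomials as the substitution homomorphism.\<close>

definition push :: "('a \<Rightarrow> 'b) \<Rightarrow> ('a \<Rightarrow>\<^sub>0 'c::comm_monoid_add) \<Rightarrow> ('b \<Rightarrow>\<^sub>0 'c)" where
  "push r p = (\<Sum>a\<in>keys p. single (r a) (lookup p a))"

lemma push_0 [simp]: "push r 0 = 0"
  by (simp add: push_def)

lemma push_add: "push r (p + q) = push r p + push r q"
  unfolding push_def by (rule setsum_keys_plus_distrib) (auto simp: single_add)

lemma push_single [simp]: "push r (single a c) = single (r a) c"
  by (simp add: push_def)

lemma push_sum: "push r (sum f A) = (\<Sum>i\<in>A. push r (f i))"
  by (induction A rule: infinite_finite_induct) (auto simp: push_add)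

lemma push_diff: "push r (p - q) = push r p - push r (q :: 'a \<Rightarrow>\<^sub>0 'c::ab_group_add)"
  by (metis add_diff_cancel diff_add_cancel push_add)

lemma keys_push: "keys (push r p) \<subseteq> r ` keys p"
  unfolding push_def by (rule order.trans[OF keys_sum]) auto

lemma lookup_push: "lookup (push r p) b = (\<Sum>a\<in>{a \<in> keys p. r a = b}. lookup p a)"
  by (simp add: push_def lookup_sum lookup_single when_def sum.If_cases Int_def)

lemma push_mult:
  fixes p q :: "('k::field) mpoly"
  assumes "\<And>a b. r (a + b) = r a + r b"
  shows "push r (p * q) = push r p * (push r q :: 'k mpoly)"
proof -
  have "push r (p * q) = push r ((\<Sum>a\<in>keys p. single a (lookup p a)) * (\<Sum>b\<in>keys q. single b (lookup q b)))"
    by (simp flip: poly_eq_sum_single)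
  also have "\<dots> = push r p * push r q"
    unfolding sum_product push_sum push_def[of r p] push_def[of r q]
    by (simp add: mult_single assms)
  finally show ?thesis .
qed

lemma E_setI: "1 \<le> i \<Longrightarrow> i * (s - 1) + 1 \<le> t \<Longrightarrow> t \<le> i * s \<Longrightarrow> t \<in> E_set s"
  unfolding E_set_def by auto

text \<open>Variable \<open>j * s\<close> is the apex of block \<open>j\<close>; variables \<open>j * s + i\<close> with \<open>1 \<le> i < s\<close> are its body.\<close>

locale blocks =
  fixes s t :: nat
  assumes s: "2 \<le> s" and t: "0 < t"
begin

abbreviation n :: nat where "n \<equiv> s * s"

definition body :: "nat \<Rightarrow> (nat \<Rightarrow>\<^sub>0 nat) \<Rightarrow> nat" where
  "body j m = (\<Sum>i\<in>{1..<s}. lookup m (j * s + i))"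

definition transversal_ok :: "(nat \<Rightarrow>\<^sub>0 nat) \<Rightarrow> bool" where
  "transversal_ok m \<longleftrightarrow> (\<forall>\<tau>. (\<forall>j<s. \<tau> j \<in> {1..<s}) \<longrightarrow> t \<le> (\<Sum>j<s. lookup m (j * s + \<tau> j)))"

text \<open>\<open>Q k\<close> describes the image of the \<open>t\<close>-th symbolic power after the apices of blocks \<open>1, \<dots>, k\<close> are
  identified with the variable \<open>0\<close>; the truncated difference \<open>t - body j m\<close> is the exponent that the
  apex of block \<open>j\<close> has to supply.\<close>

definition Q :: "nat \<Rightarrow> (nat \<Rightarrow>\<^sub>0 nat) \<Rightarrow> bool" where
  "Q k m \<longleftrightarrow> (\<Sum>j\<le>k. t - body j m) \<le> lookup m 0 \<and>
     (\<forall>j. k < j \<and> j < s \<longrightarrow> t \<le> lookup m (j * s) + body j m) \<and> transversal_ok m"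

definition covers :: "nat set set" where
  "covers = (\<lambda>j. {j * s..<j * s + s}) ` {..<s} \<union>
     (\<lambda>\<tau>. (\<lambda>j. j * s + \<tau> j) ` {..<s}) ` {\<tau>. \<forall>j<s. \<tau> j \<in> {1..<s}}"

lemma index_eq_iff: "i < s \<Longrightarrow> i' < s \<Longrightarrow> j * s + i = j' * s + i' \<longleftrightarrow> j = j' \<and> i = i'"
proof -
  have "(a * s + b) div s = a \<and> (a * s + b) mod s = b" if "b < s" for a b
    using that by simp
  then show "i < s \<Longrightarrow> i' < s \<Longrightarrow> j * s + i = j' * s + i' \<longleftrightarrow> j = j' \<and> i = i'" by metis
qed

lemma index_less:
  assumes "j < s" "i < s"
  shows "j * s + i < n"
proof -
  have "Suc j * s \<le> s * s" using assms by (intro mult_le_mono1) simp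
  then show ?thesis using assms by simp
qed

lemma index_cases:
  assumes "v < n"
  obtains j i where "v = j * s + i" "j < s" "i < s"
  using that[of "v div s" "v mod s"] less_mult_imp_div_less[OF assms] s by simp

text \<open>Apices lie in blocks only, so a set of the family containing a block is a block with the
  same apex. A transversal has points in blocks 0 and 1, which are distinct as
  \<open>2 \<le> s\<close>, so no block contains it; two comparable transversals agree block by
  block.\<close>

lemma cover_family: "cover_family n covers"
proof
  fix C assume "C \<in> covers"
  then show "C \<subseteq> {..<n}"
    unfolding covers_def
  proof
    assume "C \<in> (\<lambda>j. {j * s..<j * s + s}) ` {..<s}"
    then obtain j where j: "j < s" "C = {j * s..<j * s + s}" by auto
    have "j * s + s \<le> s * s" using j(1) mult_le_mono1[of "Suc j" s s] by simp
    then show ?thesis using j(2) by auto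
  qed (auto intro!: index_less)
next
  fix C D assume CD: "C \<in> covers" "D \<in> covers" "C \<subseteq> D"
  have inD: "\<exists>l<s. D = {l * s..<l * s + s}" if D: "j * s \<in> D" for j
  proof -
    have "j * s \<notin> (\<lambda>j. j * s + \<tau> j) ` {..<s}" if \<tau>: "\<forall>j<s. \<tau> j \<in> {1..<s}" for \<tau>
    proof
      assume "j * s \<in> (\<lambda>j. j * s + \<tau> j) ` {..<s}"
      then obtain l where l: "l < s" "j * s = l * s + \<tau> l" by auto
      then have "\<tau> l \<in> {1..<s}" using \<tau> by blast
      then show False using l index_eq_iff[of 0 "\<tau> l" j l] by simp
    qed
    then show ?thesis using CD(2) D unfolding covers_def by blast
  qed
  from CD(1) consider (block) j where "j < s" "C = {j * s..<j * s + s}"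
    | (trans) \<tau> where "\<forall>j<s. \<tau> j \<in> {1..<s}" "C = (\<lambda>j. j * s + \<tau> j) ` {..<s}"
    unfolding covers_def by auto
  then show "C = D"
  proof cases
    case block
    then have "j * s \<in> D" using CD(3) s by auto
    then obtain l where l: "l < s" "D = {l * s..<l * s + s}" using inD by blast
    have "l * s \<le> j * s" "j * s < Suc l * s" using \<open>j * s \<in> D\<close> l(2) by auto
    then have "l \<le> j" "j < Suc l" using s by (simp_all only: mult_le_cancel2 mult_less_cancel2)
    then have "l = j" by simp
    then show ?thesis using block l by simp
  next
    case trans
    have in01: "0 * s + \<tau> 0 \<in> D" "1 * s + \<tau> 1 \<in> D"
      using CD(3) s unfolding trans(2) image_subset_iff by (auto dest: bspec[of _ _ 0] bspec[of _ _ 1])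
    from CD(2) consider (block) l where "l < s" "D = {l * s..<l * s + s}"
      | (tr) \<sigma> where "\<forall>j<s. \<sigma> j \<in> {1..<s}" "D = (\<lambda>j. j * s + \<sigma> j) ` {..<s}"
      unfolding covers_def by auto
    then show ?thesis
    proof cases
      case block
      have "\<tau> 0 < s" using trans(1) s by auto
      moreover have "l * s \<le> \<tau> 0" using in01(1) block(2) by simp
      ultimately have "l = 0" by (cases l) auto
      then show ?thesis using in01(2) block(2) by simp
    next
      case tr
      have "\<tau> j = \<sigma> j" if j: "j < s" for j
      proof -
        have "j * s + \<tau> j \<in> D" using CD(3) trans(2) j by auto
        then obtain l where "l < s" "j * s + \<tau> j = l * s + \<sigma> l" using tr(2) by auto
        then show ?thesis using index_eq_iff[of "\<tau> j" "\<sigma> l" j l] trans(1) tr(1) j by auto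
      qed
      then show ?thesis using trans(2) tr(2) by auto
    qed
  qed
qed

lemma covers_iff_Q: "(\<forall>C\<in>covers. t \<le> deg_on C m) \<longleftrightarrow> Q 0 m"
proof -
  have block: "deg_on {j * s..<j * s + s} m = lookup m (j * s) + body j m" for j
  proof -
    have "deg_on {j * s..<j * s + s} m = (\<Sum>i\<in>{0..<s}. lookup m (j * s + i))"
      unfolding deg_on_def using sum.shift_bounds_nat_ivl[of "lookup m" 0 "j * s" s]
      by (simp add: add.commute)
    also have "\<dots> = lookup m (j * s) + body j m"
      unfolding body_def using s by (subst sum.atLeast_Suc_lessThan) (auto simp: One_nat_def)
    finally show ?thesis .
  qed
  have trans: "deg_on ((\<lambda>j. j * s + \<tau> j) ` {..<s}) m = (\<Sum>j<s. lookup m (j * s + \<tau> j))"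
    if "\<forall>j<s. \<tau> j \<in> {1..<s}" for \<tau>
    unfolding deg_on_def
  proof (subst sum.reindex)
    show "inj_on (\<lambda>j. j * s + \<tau> j) {..<s}"
      using that index_eq_iff by (auto simp: inj_on_def)
  qed simp
  have "(\<forall>C\<in>covers. t \<le> deg_on C m) \<longleftrightarrow>
      (\<forall>j<s. t \<le> lookup m (j * s) + body j m) \<and> transversal_ok m"
    unfolding covers_def transversal_ok_def using trans by (auto simp: ball_Un block)
  also have "(\<forall>j<s. t \<le> lookup m (j * s) + body j m) \<longleftrightarrow>
      t - body 0 m \<le> lookup m 0 \<and> (\<forall>j. 0 < j \<and> j < s \<longrightarrow> t \<le> lookup m (j * s) + body j m)"
    (is "?a \<longleftrightarrow> ?b")
  proof
    assume ?a
    then show ?b using s by (auto dest: spec[of _ 0])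
  next
    assume b: ?b
    show ?a
    proof (intro allI impI)
      fix j assume "j < s"
      then show "t \<le> lookup m (j * s) + body j m" using b by (cases "j = 0") auto
    qed
  qed
  finally show ?thesis by (simp add: Q_def)
qed

lemma body_add: "body j (a + b) = body j a + body j b"
  by (simp add: body_def lookup_add sum.distrib)

lemma body_single:
  assumes "i < s"
  shows "body j (single (l * s + i) c) = (if l = j \<and> i \<noteq> 0 then c else 0)"
proof -
  have "body j (single (l * s + i) c) = (\<Sum>i'\<in>{1..<s}. if i' = i then (if l = j then c else 0) else 0)"
    unfolding body_def
  proof (rule sum.cong[OF refl])
    fix i' assume "i' \<in> {1..<s}"
    then show "lookup (single (l * s + i) c) (j * s + i') = (if i' = i then (if l = j then c else 0) else 0)"
      using index_eq_iff[OF assms, of i' l j] by (auto simp: lookup_single when_def)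
  qed
  also have "\<dots> = (if l = j \<and> i \<noteq> 0 then c else 0)" using assms by simp
  finally show ?thesis .
qed

lemma body_single_apex: "body j (single (l * s) c) = 0"
  using body_single[of 0 j l c] s by simp

lemma transversal_ok_add: "transversal_ok a \<Longrightarrow> transversal_ok (a + b)"
  by (auto simp: transversal_ok_def lookup_add sum.distrib intro: trans_le_add1)

lemma transversal_ok_apex: "transversal_ok (m + single (l * s) c) \<longleftrightarrow> transversal_ok m"
proof -
  have "lookup (m + single (l * s) c) (j * s + i) = lookup m (j * s + i)" if "i \<in> {1..<s}" for j i
    using index_eq_iff[of 0 i l j] that by (auto simp: lookup_add lookup_single when_def)
  then have "(\<Sum>j<s. lookup (m + single (l * s) c) (j * s + \<tau> j)) = (\<Sum>j<s. lookup m (j * s + \<tau> j))"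
    if "\<forall>j<s. \<tau> j \<in> {1..<s}" for \<tau>
    using that by (intro sum.cong) auto
  then show ?thesis by (auto simp: transversal_ok_def)
qed

lemma not_transversal_ok_0: "\<not> transversal_ok 0"
  unfolding transversal_ok_def using s t by (auto intro!: exI[of _ "\<lambda>_. 1"])

lemma Q_add:
  assumes "Q k a"
  shows "Q k (a + b)"
proof -
  have "(\<Sum>j\<le>k. t - body j (a + b)) \<le> (\<Sum>j\<le>k. t - body j a)"
    by (rule sum_mono) (simp add: body_add)
  then show ?thesis
    using assms transversal_ok_add by (force simp: Q_def lookup_add body_add)
qed

section \<open>Identifying the apices\<close>

definition merge_var :: "nat \<Rightarrow> nat \<Rightarrow> nat" where
  "merge_var k i = (if s dvd i \<and> i \<le> k * s then 0 else i)"

abbreviation merge_exp :: "nat \<Rightarrow> (nat \<Rightarrow>\<^sub>0 nat) \<Rightarrow> (nat \<Rightarrow>\<^sub>0 nat)" where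
  "merge_exp k \<equiv> push (merge_var k)"

abbreviation merge :: "nat \<Rightarrow> ('k::field) mpoly \<Rightarrow> 'k mpoly" where
  "merge k \<equiv> push (merge_exp k)"

lemma merge_var_apex: "merge_var k (j * s) = (if j \<le> k then 0 else j * s)"
  using s by (auto simp: merge_var_def)

lemma merge_var_body: "i \<in> {1..<s} \<Longrightarrow> merge_var k (j * s + i) = j * s + i"
  by (auto simp: merge_var_def dest: dvd_imp_le)

lemma merge_var_le: "merge_var k i \<le> i"
  by (simp add: merge_var_def)

lemma keys_merge_exp: "keys m \<subseteq> {..<n} \<Longrightarrow> keys (merge_exp k m) \<subseteq> {..<n}"
  using keys_push[of "merge_var k" m] le_less_trans[OF merge_var_le, of _ n k] by auto

lemma merge_Pn: "p \<in> Pn n \<Longrightarrow> merge k p \<in> Pn n"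
  using keys_push[of "merge_exp k" p] keys_merge_exp unfolding Pn_def by blast

lemma merge_mult: "merge k (p * q) = merge k p * merge k q"
  by (rule push_mult) (rule push_add)

lemma merge_X: "merge k (X i) = X (merge_var k i)"
  by (simp add: X_def)

lemma lookup_merge_exp_fixed:
  assumes "i \<noteq> 0" "merge_var k i = i"
  shows "lookup (merge_exp k m) i = lookup m i"
proof -
  have "{a \<in> keys m. merge_var k a = i} = (if i \<in> keys m then {i} else {})"
    using assms by (auto simp: merge_var_def split: if_splits)
  then show ?thesis by (auto simp: lookup_push in_keys_iff)
qed

lemma lookup_merge_exp_0: "lookup (merge_exp k m) 0 = (\<Sum>j\<le>k. lookup m (j * s))"
proof -
  have "merge_var k a = 0 \<longleftrightarrow> a \<in> (\<lambda>j. j * s) ` {..k}" for a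
  proof
    assume "merge_var k a = 0"
    then have "s dvd a" "a \<le> k * s" by (auto simp: merge_var_def split: if_splits)
    then obtain j where "a = j * s" by (metis dvd_def mult.commute)
    then show "a \<in> (\<lambda>j. j * s) ` {..k}" using \<open>a \<le> k * s\<close> s by auto
  qed (auto simp: merge_var_apex)
  then have "{a \<in> keys m. merge_var k a = 0} = keys m \<inter> (\<lambda>j. j * s) ` {..k}" by auto
  then have "lookup (merge_exp k m) 0 = (\<Sum>a\<in>keys m \<inter> (\<lambda>j. j * s) ` {..k}. lookup m a)"
    by (simp only: lookup_push)
  also have "\<dots> = (\<Sum>a\<in>(\<lambda>j. j * s) ` {..k}. lookup m a)"
    by (rule sum.mono_neutral_left) (auto simp: in_keys_iff)
  also have "\<dots> = (\<Sum>j\<le>k. lookup m (j * s))"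
    using s by (subst sum.reindex) (auto simp: inj_on_def)
  finally show ?thesis .
qed

lemma lookup_merge_exp_body: "i \<in> {1..<s} \<Longrightarrow> lookup (merge_exp k m) (j * s + i) = lookup m (j * s + i)"
  by (rule lookup_merge_exp_fixed) (auto simp: merge_var_body)

lemma body_merge_exp: "body j (merge_exp k m) = body j m"
  by (simp add: body_def lookup_merge_exp_body)

lemma transversal_ok_merge_exp: "transversal_ok (merge_exp k m) \<longleftrightarrow> transversal_ok m"
proof -
  have "(\<Sum>j<s. lookup (merge_exp k m) (j * s + \<tau> j)) = (\<Sum>j<s. lookup m (j * s + \<tau> j))"
    if "\<forall>j<s. \<tau> j \<in> {1..<s}" for \<tau>
    using that by (intro sum.cong) (auto simp: lookup_merge_exp_body)
  then show ?thesis by (auto simp: transversal_ok_def)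
qed

lemma Q_merge_exp:
  "Q k (merge_exp k m) \<longleftrightarrow> (\<Sum>j\<le>k. t - body j m) \<le> (\<Sum>j\<le>k. lookup m (j * s)) \<and>
     (\<forall>j. k < j \<and> j < s \<longrightarrow> t \<le> lookup m (j * s) + body j m) \<and> transversal_ok m"
proof -
  have "lookup (merge_exp k m) (j * s) = lookup m (j * s)" if "k < j" for j
    by (rule lookup_merge_exp_fixed) (use that s in \<open>auto simp: merge_var_apex\<close>)
  then show ?thesis
    by (simp add: Q_def body_merge_exp transversal_ok_merge_exp lookup_merge_exp_0)
qed

lemma Q_0_imp_Q_merge_exp:
  assumes "Q 0 m" "k < s"
  shows "Q k (merge_exp k m)"
  unfolding Q_merge_exp
proof (intro conjI)
  have all: "t \<le> lookup m (j * s) + body j m" if "j < s" for j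
    using assms(1) that by (cases "j = 0") (auto simp: Q_def)
  show "(\<Sum>j\<le>k. t - body j m) \<le> (\<Sum>j\<le>k. lookup m (j * s))"
  proof (rule sum_mono)
    fix j assume "j \<in> {..k}"
    then show "t - body j m \<le> lookup m (j * s)" using all[of j] assms(2) by auto
  qed
  show "\<forall>j. k < j \<and> j < s \<longrightarrow> t \<le> lookup m (j * s) + body j m" using all by simp
  show "transversal_ok m" using assms(1) by (simp add: Q_def)
qed

text \<open>The exponent of the variable 0 is large enough to pay for all deficits. Handing to the
  apex of each block \<open>j\<close> with \<open>1 \<le> j \<le> k\<close> exactly its deficit, and
  leaving the rest at 0, undoes the identification.\<close>

lemma Q_lift:
  assumes Q: "Q k (merge_exp k m0)" and k: "k < s" and keys: "keys m0 \<subseteq> {..<n}"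
  obtains m where "Q 0 m" "merge_exp k m = merge_exp k m0" "keys m \<subseteq> {..<n}"
proof -
  define u where "u = merge_exp k m0"
  have idem: "merge_exp k u = u"
  proof (rule poly_mapping_eqI)
    fix i
    show "lookup (merge_exp k u) i = lookup u i"
    proof (cases "merge_var k i = i \<and> i \<noteq> 0")
      case True
      then show ?thesis by (simp add: lookup_merge_exp_fixed)
    next
      case False
      have z: "lookup u (j * s) = 0" if "0 < j" "j \<le> k" for j
      proof -
        have "{a \<in> keys m0. merge_var k a = j * s} = {}"
          using that s by (auto simp: merge_var_def split: if_splits)
        then show ?thesis unfolding u_def lookup_push by (simp only: sum.empty)
      qed
      show ?thesis
      proof (cases "i = 0")
        case True
        have "(\<Sum>j\<le>k. lookup u (j * s)) = (\<Sum>j\<in>{..k}. if j = 0 then lookup u 0 else 0)"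
          by (rule sum.cong) (auto simp: z)
        then show ?thesis using True by (simp add: lookup_merge_exp_0)
      next
        case nz: False
        then have i: "s dvd i" "i \<le> k * s" using False by (auto simp: merge_var_def split: if_splits)
        then obtain j where j: "i = j * s" by (auto simp: dvd_def mult.commute)
        then have "0 < j" "j \<le> k" using nz i s by auto
        have "{a \<in> keys u. merge_var k a = i} = {}"
          using i nz by (auto simp: merge_var_def split: if_splits)
        then have "lookup (merge_exp k u) i = 0" unfolding lookup_push by (simp only: sum.empty)
        then show ?thesis using z[OF \<open>0 < j\<close> \<open>j \<le> k\<close>] j by simp
      qed
    qed
  qed
  \<comment> \<open>The amount to be moved away from the variable 0. Block 0 is excluded, because
    its own deficit has to remain there; \<open>le\<close> records that it does.\<close>
  define a where "a = (\<Sum>j\<in>{1..k}. t - body j u)"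
  have le: "t - body 0 u + a \<le> lookup u 0"
    using Q by (simp add: Q_def a_def atMost_atLeast0 sum.atLeast_Suc_atMost flip: u_def One_nat_def)
  define r where "r = u - single 0 a"
  have r: "u = r + single 0 a"
    unfolding r_def using le by (intro poly_mapping_eqI) (auto simp: lookup_add lookup_minus lookup_single when_def)
  define z where "z = (\<Sum>j\<in>{1..k}. single (j * s) (t - body j u))"
  define m where "m = r + z"
  have kz: "keys z \<subseteq> (\<lambda>j. j * s) ` {1..k}"
    unfolding z_def by (rule order.trans[OF keys_sum]) (auto split: if_splits)
  have lz: "lookup z (j * s) = (if j \<in> {1..k} then t - body j u else 0)" for j
  proof -
    have "lookup z (j * s) = (\<Sum>l\<in>{1..k}. if l = j then t - body j u else 0)"
      unfolding z_def lookup_sum using s by (intro sum.cong) (auto simp: lookup_single when_def)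
    then show ?thesis by simp
  qed
  have bz: "body j z = 0" for j
  proof -
    have "lookup z (j * s + i) = 0" if "i \<in> {1..<s}" for i
    proof -
      have "j * s + i \<notin> (\<lambda>j. j * s) ` {1..k}"
        using that index_eq_iff[of i 0 j] by auto
      then show ?thesis using kz by (auto simp: in_keys_iff)
    qed
    then show ?thesis by (simp add: body_def)
  qed
  have body_u: "body j u = body j r" for j
    by (subst r) (simp add: body_add body_single_apex[of j 0, simplified])
  have body_m: "body j m = body j u" for j
    by (simp add: m_def body_add bz body_u)
  have lr: "lookup r (j * s) = (if j = 0 then lookup u 0 - a else lookup u (j * s))" for j
    using s by (auto simp: r_def lookup_minus lookup_single when_def)
  have "merge_exp k z = (\<Sum>j\<in>{1..k}. single 0 (t - body j u))"
    unfolding z_def push_sum by (intro sum.cong) (auto simp: merge_var_apex)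
  also have "\<dots> = single 0 a"
    unfolding a_def by (induction k) (auto simp: single_add)
  also have "\<dots> = merge_exp k (single 0 a)"
    by (simp add: merge_var_def)
  finally have "merge_exp k m = merge_exp k u"
    by (subst r) (simp add: m_def push_add)
  then have "merge_exp k m = u" by (simp add: idem)
  moreover have "Q 0 m"
    unfolding Q_def
  proof (intro conjI allI impI)
    show "(\<Sum>j\<le>0. t - body j m) \<le> lookup m 0"
      using le lr[of 0] lz[of 0] by (simp add: body_m) (simp add: m_def lookup_add)
    show "transversal_ok m"
    proof -
      have "transversal_ok r"
        using Q transversal_ok_apex[of r 0 a] by (simp add: Q_def r flip: u_def)
      then show ?thesis unfolding m_def by (rule transversal_ok_add)
    qed
    fix j assume j: "0 < j \<and> j < s"
    have "t \<le> lookup u (j * s) + body j u" if "k < j"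
      using Q j that by (simp add: Q_def flip: u_def)
    then show "t \<le> lookup m (j * s) + body j m"
      using j lr[of j] lz[of j] unfolding body_m by (auto simp: m_def lookup_add)
  qed
  moreover have "keys m \<subseteq> {..<n}"
  proof -
    have "keys u \<subseteq> {..<n}" unfolding u_def by (rule keys_merge_exp[OF keys])
    moreover have "keys r \<subseteq> keys u" by (auto simp: r_def in_keys_iff lookup_minus)
    moreover have "keys z \<subseteq> {..<n}"
      using kz k index_less[of _ 0] s by fastforce
    ultimately show ?thesis unfolding m_def keys_plus_nat by auto
  qed
  ultimately show ?thesis using that u_def by blast
qed

section \<open>The quotient by differences of apices\<close>

definition J :: "('k::field) mpoly set" where
  "J = mon_ideal n (Q 0)"

definition fs :: "nat \<Rightarrow> ('k::field) mpoly list" where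
  "fs k = map (\<lambda>j. X (j * s) - X 0) [1..<Suc k]"

text \<open>The preimage under the substitution, so that all ideals of the sequence live in the same
  ring and no variable has to be discarded.\<close>

definition L :: "nat \<Rightarrow> ('k::field) mpoly set" where
  "L k = {g \<in> Pn n. merge k g \<in> mon_ideal n (Q k)}"

lemma is_ideal_mon_Q: "is_ideal n (mon_ideal n (Q k))"
  by (rule is_ideal_mon_ideal) (rule Q_add)

lemma is_ideal_J: "is_ideal n J"
  unfolding J_def by (rule is_ideal_mon_Q)

lemma is_ideal_L: "is_ideal n (L k :: ('k::field) mpoly set)"
proof (rule is_idealI)
  fix a b :: "'k mpoly" assume "a \<in> L k" "b \<in> L k"
  then show "a + b \<in> L k"
    by (auto simp: L_def push_add Pn_add intro: is_ideal_add[OF is_ideal_mon_Q])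
next
  fix r a :: "'k mpoly" assume "r \<in> Pn n" "a \<in> L k"
  then show "r * a \<in> L k"
    by (auto simp: L_def merge_mult Pn_mult merge_Pn intro: is_ideal_mult[OF is_ideal_mon_Q])
qed (auto simp: L_def is_ideal_0[OF is_ideal_mon_Q])

lemma apex_less: "j < s \<Longrightarrow> j * s < n"
  using index_less[of j 0] s by simp

lemma X_0_Pn: "X 0 \<in> Pn n"
  using apex_less[of 0] s by (intro Pn_X) simp

lemma set_fs: "set (fs k) = (\<lambda>j. X (j * s) - X 0) ` {1..k}"
  by (simp add: fs_def atLeastLessThanSuc_atLeastAtMost del: upt_Suc)

lemma length_fs [simp]: "length (fs k) = k"
  by (simp add: fs_def)

lemma set_fs_Pn: "k < s \<Longrightarrow> set (fs k) \<subseteq> Pn n"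
  unfolding set_fs by (auto intro!: Pn_diff Pn_X apex_less X_0_Pn)

text \<open>Modulo the differences each variable is congruent to its image, so the variables of a
  monomial can be exchanged one at a time; the induction is on the total degree.\<close>

lemma single_merge_congruent:
  fixes A :: "('k::field) mpoly set"
  assumes A: "is_ideal n A" "set (fs k) \<subseteq> A" and k: "k < s" and m: "keys m \<subseteq> {..<n}"
  shows "single m c - single (merge_exp k m) c \<in> A"
  using m
proof (induction "deg_on {..<n} m" arbitrary: m)
  case 0
  then have "keys m = {}" using deg_on_eq_0_iff[of "{..<n}" m] by (metis finite_lessThan inf.absorb1)
  then have "m = 0" by simp
  then show ?case by (simp add: is_ideal_0[OF A(1)])
next
  case (Suc d)
  then obtain i where i: "i \<in> keys m" "i < n"
    using deg_on_eq_0_iff[of "{..<n}" m] by auto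
  obtain m' where m': "m = m' + single i 1" "keys m' \<subseteq> keys m" using exponent_split[OF i(1)] by metis
  have "single m' c - single (merge_exp k m') c \<in> A"
    using Suc m' i by (auto simp: deg_on_add deg_on_single)
  then have 1: "X i * (single m' c - single (merge_exp k m') c) \<in> A"
    using i by (intro is_ideal_mult[OF A(1)] Pn_X)
  have "X i - X (merge_var k i) \<in> A"
  proof (cases "merge_var k i = i")
    case True
    then show ?thesis by (simp add: is_ideal_0[OF A(1)])
  next
    case False
    then have "s dvd i" "i \<le> k * s" "i \<noteq> 0" "merge_var k i = 0" by (auto simp: merge_var_def split: if_splits)
    then obtain j where "i = j * s" "j \<in> {1..k}" using s by (auto simp: dvd_def mult.commute Suc_le_eq)
    then have "X i - X (merge_var k i) \<in> set (fs k)"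
      using \<open>merge_var k i = 0\<close> by (auto simp: set_fs)
    then show ?thesis using A(2) by auto
  qed
  then have 2: "single (merge_exp k m') c * (X i - X (merge_var k i)) \<in> A"
    using Suc.prems m' by (intro is_ideal_mult[OF A(1)] Pn_single keys_merge_exp) auto
  have "single m c - single (merge_exp k m) c =
     X i * (single m' c - single (merge_exp k m') c) +
     single (merge_exp k m') c * (X i - X (merge_var k i))"
    by (simp add: m' X_def push_add mult_single algebra_simps)
  then show ?case using is_ideal_add[OF A(1) 1 2] by simp
qed

text \<open>For the harder inclusion, \<open>g\<close> is congruent to \<open>merge k g\<close>
  modulo the differences. Each monomial of the latter comes from a monomial of \<open>g\<close>,
  hence lifts by \<open>Q_lift\<close> to a monomial in \<open>J\<close> that has it as image and is
  congruent to it.\<close>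

lemma ideal_gen_fs:
  assumes k: "k < s"
  shows "ideal_gen n (J \<union> set (fs k)) = (L k :: ('k::field) mpoly set)"
proof
  let ?A = "ideal_gen n (J \<union> set (fs k)) :: 'k mpoly set"
  have "mon_ideal n (Q 0) \<subseteq> (L k :: 'k mpoly set)"
  proof (rule mon_ideal_subsetI[OF is_ideal_L])
    fix m and c :: 'k assume "Q 0 m" "keys m \<subseteq> {..<n}"
    then show "single m c \<in> L k"
      using Q_0_imp_Q_merge_exp[OF _ k, of m] keys_merge_exp[of m k]
      by (simp add: L_def Pn_single single_in_mon_ideal)
  qed
  moreover have "set (fs k) \<subseteq> (L k :: 'k mpoly set)"
  proof
    fix f :: "'k mpoly" assume f: "f \<in> set (fs k)"
    then obtain j where "j \<le> k" "f = X (j * s) - X 0" by (auto simp: set_fs)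
    then have "merge k f = 0" using merge_var_apex[of k 0] by (simp add: push_diff merge_X merge_var_apex)
    then show "f \<in> L k"
      using f set_fs_Pn[OF k] is_ideal_0[OF is_ideal_mon_Q] by (auto simp: L_def)
  qed
  ultimately show "?A \<subseteq> L k"
    by (intro ideal_gen_least is_ideal_L) (simp add: J_def)
  have idA: "is_ideal n ?A"
    using is_ideal_subset[OF is_ideal_J] set_fs_Pn[OF k] by (intro is_ideal_ideal_gen) auto
  have fsA: "set (fs k) \<subseteq> ?A" by (auto intro: ideal_gen.gen)
  show "L k \<subseteq> ?A"
  proof
    fix g :: "'k mpoly" assume g: "g \<in> L k"
    have kg: "\<And>m. m \<in> keys g \<Longrightarrow> keys m \<subseteq> {..<n}" using g by (auto simp: L_def dest: Pn_keys)
    have "g - merge k g = (\<Sum>m\<in>keys g. single m (lookup g m)) - merge k g"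
      by (simp flip: poly_eq_sum_single)
    also have "\<dots> = (\<Sum>m\<in>keys g. single m (lookup g m) - single (merge_exp k m) (lookup g m))"
      by (simp add: push_def[of "merge_exp k"] sum_subtractf)
    also have "\<dots> \<in> ?A"
      by (intro is_ideal_sum[OF idA] single_merge_congruent[OF idA fsA k] kg)
    finally have 1: "g - merge k g \<in> ?A" .
    have "(\<Sum>u\<in>keys (merge k g). single u (lookup (merge k g) u)) \<in> ?A"
    proof (rule is_ideal_sum[OF idA])
      fix u assume u: "u \<in> keys (merge k g)"
      let ?c = "lookup (merge k g) u"
      have "Q k u" using u g by (auto simp: L_def mon_ideal_def)
      moreover obtain m0 where m0: "m0 \<in> keys g" "u = merge_exp k m0"
        using u keys_push[of "merge_exp k" g] by auto
      ultimately obtain m where m: "Q 0 m" "merge_exp k m = u" "keys m \<subseteq> {..<n}"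
        using Q_lift[OF _ k kg] by metis
      have "single m ?c \<in> ?A"
        using m by (auto simp: J_def intro!: ideal_gen.gen single_in_mon_ideal)
      moreover have "single m ?c - single u ?c \<in> ?A"
        using single_merge_congruent[OF idA fsA k m(3), of ?c] m(2) by simp
      ultimately have "single m ?c - (single m ?c - single u ?c) \<in> ?A" by (rule is_ideal_diff[OF idA])
      then show "single u ?c \<in> ?A" by simp
    qed
    then have "merge k g \<in> ?A" by (simp flip: poly_eq_sum_single)
    then have "(g - merge k g) + merge k g \<in> ?A" by (rule is_ideal_add[OF idA 1])
    then show "g \<in> ?A" by simp
  qed
qed

lemma keys_uminus_X: "m \<in> keys (- X i :: ('k::field) mpoly) \<Longrightarrow> m = single i 1"
  by (simp add: X_def keys_uminus_eq)

text \<open>\<open>Q k\<close> is the conjunction of a condition not involving the variable \<open>(k + 1) * s\<close> and one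
  not involving the variable \<open>0\<close>.\<close>

lemma next_fs_regular:
  fixes g :: "('k::field) mpoly"
  assumes k: "Suc k < s" and g: "g \<in> Pn n" and fg: "(X (Suc k * s) - X 0) * g \<in> L k"
  shows "g \<in> L k"
proof -
  define A where "A m \<longleftrightarrow> (\<Sum>j\<le>k. t - body j m) \<le> lookup m 0 \<and>
     (\<forall>j. Suc k < j \<and> j < s \<longrightarrow> t \<le> lookup m (j * s) + body j m) \<and> transversal_ok m" for m
  define B where "B m \<longleftrightarrow> t \<le> lookup m (Suc k * s) + body (Suc k) m" for m
  have QAB: "Q k m \<longleftrightarrow> A m \<and> B m" for m
  proof -
    have "(\<forall>j. k < j \<and> j < s \<longrightarrow> P j) \<longleftrightarrow> (\<forall>j. Suc k < j \<and> j < s \<longrightarrow> P j) \<and> P (Suc k)" for P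
      using k by (metis Suc_lessD Suc_lessI lessI)
    from this[of "\<lambda>j. t \<le> lookup m (j * s) + body j m"]
    show ?thesis unfolding Q_def A_def B_def by argo
  qed
  let ?g = "merge k g"
  have gP: "?g \<in> Pn n" using g by (rule merge_Pn)
  have mv: "merge_var k (Suc k * s) = Suc k * s" "merge_var k 0 = 0"
    using merge_var_apex[of k "Suc k"] by (auto simp: merge_var_def)
  have "(X (Suc k * s) - X 0) * ?g \<in> mon_ideal n (Q k)"
    using fg mv by (simp add: L_def merge_mult push_diff merge_X)
  then have fA: "(X (Suc k * s) - X 0) * ?g \<in> mon_ideal n A"
    and fB: "(X (Suc k * s) - X 0) * ?g \<in> mon_ideal n B"
    by (auto simp: mon_ideal_def QAB)
  have "?g \<in> mon_ideal n A"
  proof (rule mon_ideal_cancel[OF _ _ _ gP, of A "Suc k * s" "- X 0"])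
    fix a b assume a: "A a"
    have "(\<Sum>j\<le>k. t - body j (a + b)) \<le> (\<Sum>j\<le>k. t - body j a)"
      by (rule sum_mono) (simp add: body_add)
    then show "A (a + b)"
      using a transversal_ok_add by (force simp: A_def lookup_add body_add)
  next
    fix m assume "A (m + single (Suc k * s) 1)"
    moreover have "lookup (single (Suc k * s) (1::nat)) (j * s) = 0" if "Suc k \<noteq> j" for j
      using that s by (auto simp: lookup_single when_def simp del: mult_Suc)
    moreover from this[of 0] have "lookup (single (Suc k * s) (1::nat)) 0 = 0" by simp
    ultimately show "A m"
      unfolding A_def transversal_ok_apex body_add body_single_apex lookup_add by simp
  next
    fix m assume "m \<in> keys (- X 0 :: 'k mpoly)"
    then have "m = single 0 1" by (rule keys_uminus_X)
    then show "Suc k * s \<notin> keys m" using s by simp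
  qed (use fA in simp)
  moreover have "?g \<in> mon_ideal n B"
  proof (rule mon_ideal_cancel[OF _ _ _ gP, of B 0 "- X (Suc k * s)"])
    fix a b assume "B a"
    then show "B (a + b)" by (simp add: B_def lookup_add body_add)
  next
    fix m assume "B (m + single 0 1)"
    then show "B m"
      using body_single_apex[of "Suc k" 0 1] s
      by (auto simp: B_def lookup_add body_add lookup_one when_def)
  next
    fix m assume "m \<in> keys (- X (Suc k * s) :: 'k mpoly)"
    then have "m = single (Suc k * s) 1" by (rule keys_uminus_X)
    then show "0 \<notin> keys m" using s by simp
  next
    have "(X 0 + - X (Suc k * s)) * ?g = - ((X (Suc k * s) - X 0) * ?g)" by (simp add: algebra_simps)
    moreover have "is_ideal n (mon_ideal n B :: 'k mpoly set)"
      by (rule is_ideal_mon_ideal) (simp add: B_def lookup_add body_add)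
    ultimately show "(X 0 + - X (Suc k * s)) * ?g \<in> mon_ideal n B"
      using is_ideal_uminus fB by metis
  qed
  ultimately show ?thesis using g by (auto simp: L_def mon_ideal_def QAB)
qed

lemma X_in_max_ideal: "i < n \<Longrightarrow> X i \<in> max_ideal n"
proof -
  have "single i (1::nat) \<noteq> 0" by (metis lookup_single_eq lookup_zero zero_neq_one)
  then show "i < n \<Longrightarrow> X i \<in> max_ideal n"
    by (simp add: max_ideal_def Pn_X) (simp add: X_def lookup_single when_def)
qed

lemma J_max_ideal: "J \<subseteq> max_ideal n"
proof -
  have "\<not> Q 0 0" using not_transversal_ok_0 by (simp add: Q_def)
  then show ?thesis by (auto simp: J_def mon_ideal_def max_ideal_def in_keys_iff)
qed

lemma ideal_gen_neq_Pn:
  fixes gs :: "('k::field) mpoly list"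
  assumes "set gs \<subseteq> max_ideal n"
  shows "ideal_gen n (J \<union> set gs) \<noteq> Pn n"
proof -
  have "ideal_gen n (J \<union> set gs) \<subseteq> max_ideal n"
    using assms J_max_ideal by (intro ideal_gen_least is_ideal_max_ideal) auto
  moreover have "(1 :: 'k mpoly) \<notin> max_ideal n" by (simp add: max_ideal_def)
  ultimately show ?thesis using Pn_1 by blast
qed

lemma set_fs_max_ideal: "k < s \<Longrightarrow> set (fs k) \<subseteq> max_ideal n"
  unfolding set_fs using s apex_less[of 0]
  by (auto intro!: is_ideal_diff[OF is_ideal_max_ideal] X_in_max_ideal apex_less)

lemma take_fs: "i \<le> k \<Longrightarrow> take i (fs k) = fs i"
  by (simp add: fs_def take_map take_upt One_nat_def del: upt_Suc)

lemma nth_fs: "i < k \<Longrightarrow> fs k ! i = X (Suc i * s) - X 0"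
  by (simp add: fs_def One_nat_def del: upt_Suc)

lemma regular_seq_fs:
  assumes k: "k < s"
  shows "regular_seq n (J :: ('k::field) mpoly set) (fs k)"
  unfolding regular_seq_def
proof (intro conjI allI impI ballI)
  fix i and g :: "'k mpoly" assume i: "i < length (fs k :: 'k mpoly list)" and g: "g \<in> Pn n"
    and fg: "fs k ! i * g \<in> ideal_gen n (J \<union> set (take i (fs k)))"
  have "i < k" using i by simp
  then have "ideal_gen n (J \<union> set (take i (fs k))) = (L i :: 'k mpoly set)"
    using ideal_gen_fs[of i, where 'k='k] take_fs[of i k, where 'a='k] k by simp
  moreover have "(X (Suc i * s) - X 0) * g \<in> L i"
    using fg nth_fs[OF \<open>i < k\<close>, where 'a='k] calculation by (simp del: mult_Suc)
  ultimately show "g \<in> ideal_gen n (J \<union> set (take i (fs k)))"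
    using next_fs_regular[of i g] \<open>i < k\<close> k g by simp
qed (use set_fs_max_ideal[OF k] ideal_gen_neq_Pn in auto)

section \<open>The set E(s), the additional regular form and the socle\<close>

lemma transversal_imp_E:
  assumes ok: "transversal_ok m" and small: "\<And>j. j < s \<Longrightarrow> body j m < t"
  shows "t \<in> E_set s"
proof -
  have "\<exists>i\<in>{1..<s}. \<forall>i'\<in>{1..<s}. lookup m (j * s + i) \<le> lookup m (j * s + i')" for j
  proof -
    have "Min ((\<lambda>i. lookup m (j * s + i)) ` {1..<s}) \<in> (\<lambda>i. lookup m (j * s + i)) ` {1..<s}"
      using s by (intro Min_in) auto
    then obtain i where "i \<in> {1..<s}" "lookup m (j * s + i) = Min ((\<lambda>i. lookup m (j * s + i)) ` {1..<s})"
      by auto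
    then show ?thesis by (intro bexI[of _ i]) auto
  qed
  then obtain \<tau> where \<tau>: "\<And>j. \<tau> j \<in> {1..<s}"
    "\<And>j i'. i' \<in> {1..<s} \<Longrightarrow> lookup m (j * s + \<tau> j) \<le> lookup m (j * s + i')" by metis
  define v where "v j = lookup m (j * s + \<tau> j)" for j
  have "0 \<in> {..<s}" using s by simp
  then have "Max (v ` {..<s}) \<in> v ` {..<s}" by (intro Max_in) auto
  then obtain l where l: "l < s" "v l = Max (v ` {..<s})" by auto
  have "t \<le> (\<Sum>j<s. v j)" using ok \<tau>(1) by (auto simp: transversal_ok_def v_def)
  \<comment> \<open>The number \<open>v l\<close> enters both bounds: as the largest of the minima
    it dominates the \<open>s\<close> terms of this transversal, and as the minimum of its own body
    it is at most each of the \<open>s - 1\<close> exponents there.\<close>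
  also have "\<dots> \<le> (\<Sum>j<s. v l)" by (rule sum_mono) (simp add: l)
  finally have 1: "t \<le> v l * s" by (simp add: mult.commute)
  have "(\<Sum>i\<in>{1..<s}. v l) \<le> body l m"
    unfolding body_def v_def by (rule sum_mono) (rule \<tau>(2))
  then have 2: "v l * (s - 1) < t" using small[OF l(1)] by (simp add: mult.commute)
  have "1 \<le> v l" using 1 t by (cases "v l") auto
  then show ?thesis using 1 2 by (intro E_setI[of "v l"]) auto
qed

text \<open>Each summand serves one condition: \<open>X 0\<close> the transversal condition, which
  ignores apices, and the body variable of block \<open>j\<close> a condition ignoring that body.
  Since cancellation needs just one suitable variable, all coefficients can be one.\<close>

definition last_form :: "('k::field) mpoly" where
  "last_form = X 0 + (\<Sum>j<s. X (j * s + 1))"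

lemma atMost_pred: "{..s - 1} = {..<s}"
  using s by auto

text \<open>If \<open>t\<close> is not in \<open>E_set s\<close>, some block already has body degree at least \<open>t\<close>; hence \<open>Q (s - 1)\<close>
  is a conjunction of conditions each of which misses a variable occurring in the last form.\<close>

lemma last_form_regular:
  fixes g :: "('k::field) mpoly"
  assumes tE: "t \<notin> E_set s" and g: "g \<in> Pn n" and fg: "last_form * g \<in> L (s - 1)"
  shows "g \<in> L (s - 1)"
proof -
  \<comment> \<open>Dropping the deficit of block \<open>j\<close> removes all dependence on its
    body. \<open>K j\<close> is weaker than the full inequality and equivalent to it when that
    deficit is zero. The block without deficit varies with \<open>m\<close>, so \<open>K j\<close>
    is required for every \<open>j\<close>.\<close>
  define K where "K j m \<longleftrightarrow> (\<Sum>l\<in>{..<s} - {j}. t - body l m) \<le> lookup m 0" for j m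
  have QK: "Q (s - 1) m \<longleftrightarrow> transversal_ok m \<and> (\<forall>j<s. K j m)" for m
  proof -
    have split: "(\<Sum>l<s. t - body l m) = (t - body j m) + (\<Sum>l\<in>{..<s} - {j}. t - body l m)"
      if "j < s" for j
      using that by (simp add: sum.remove)
    have Q: "Q (s - 1) m \<longleftrightarrow> (\<Sum>l<s. t - body l m) \<le> lookup m 0 \<and> transversal_ok m"
      by (auto simp: Q_def atMost_pred)
    show ?thesis
    proof
      assume "Q (s - 1) m"
      then show "transversal_ok m \<and> (\<forall>j<s. K j m)"
        unfolding Q K_def using split by fastforce
    next
      assume r: "transversal_ok m \<and> (\<forall>j<s. K j m)"
      then obtain j where "j < s" "t \<le> body j m"
        using transversal_imp_E[of m] tE by (meson not_le)
      then show "Q (s - 1) m"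
        using r split[of j] unfolding Q K_def by auto
    qed
  qed
  let ?g = "merge (s - 1) g"
  have gP: "?g \<in> Pn n" using g by (rule merge_Pn)
  have "merge (s - 1) last_form = (last_form :: 'k mpoly)"
  proof -
    have "merge_var (s - 1) (j * s + 1) = j * s + 1" for j
      using s by (intro merge_var_body) auto
    then show ?thesis
      by (simp add: last_form_def push_add push_sum merge_X) (simp add: merge_var_def)
  qed
  then have F: "last_form * ?g \<in> mon_ideal n (Q (s - 1))"
    using fg by (simp add: L_def merge_mult)
  have "?g \<in> mon_ideal n transversal_ok"
  proof (rule mon_ideal_cancel[OF _ _ _ gP, of transversal_ok 0 "\<Sum>j<s. X (j * s + 1)"])
    fix m assume "m \<in> keys (\<Sum>j<s. X (j * s + 1) :: 'k mpoly)"
    then obtain j where "m \<in> keys (X (j * s + 1) :: 'k mpoly)"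
      using keys_sum[of "\<lambda>j. X (j * s + 1) :: 'k mpoly" "{..<s}"] by auto
    then show "0 \<notin> keys m" by (auto simp: X_def)
  next
    show "(X 0 + (\<Sum>j<s. X (j * s + 1))) * ?g \<in> mon_ideal n transversal_ok"
      using F by (auto simp: mon_ideal_def QK last_form_def)
  qed (use transversal_ok_add transversal_ok_apex[of _ 0 1] in auto)
  moreover have "?g \<in> mon_ideal n (K j)" if j: "j < s" for j
  proof (rule mon_ideal_cancel[OF _ _ _ gP, of "K j" "j * s + 1" "X 0 + (\<Sum>l\<in>{..<s} - {j}. X (l * s + 1))"])
    fix a b assume a: "K j a"
    have "(\<Sum>l\<in>{..<s} - {j}. t - body l (a + b)) \<le> (\<Sum>l\<in>{..<s} - {j}. t - body l a)"
      by (rule sum_mono) (simp add: body_add)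
    then show "K j (a + b)" using a by (simp add: K_def lookup_add)
  next
    fix m assume "K j (m + single (j * s + 1) 1)"
    moreover have "body l (single (j * s + 1) 1) = 0" if "l \<noteq> j" for l
      using that s body_single[of 1 l j 1] by simp
    ultimately show "K j m"
      by (simp add: K_def lookup_add lookup_single body_add)
  next
    fix m assume "m \<in> keys (X 0 + (\<Sum>l\<in>{..<s} - {j}. X (l * s + 1)) :: 'k mpoly)"
    then consider "m \<in> keys (X 0 :: 'k mpoly)"
      | l where "l \<noteq> j" "m \<in> keys (X (l * s + 1) :: 'k mpoly)"
      using keys_add[of "X 0 :: 'k mpoly" "\<Sum>l\<in>{..<s} - {j}. X (l * s + 1)"]
        keys_sum[of "\<lambda>l. X (l * s + 1) :: 'k mpoly" "{..<s} - {j}"] by blast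
    then show "j * s + 1 \<notin> keys m"
      using s by cases (auto simp: X_def)
  next
    have "last_form = X (j * s + 1) + (X 0 + (\<Sum>l\<in>{..<s} - {j}. X (l * s + 1)) :: 'k mpoly)"
      using j by (simp add: last_form_def sum.remove[of "{..<s}" j] add.left_commute)
    then show "(X (j * s + 1) + (X 0 + (\<Sum>l\<in>{..<s} - {j}. X (l * s + 1)))) * ?g \<in> mon_ideal n (K j)"
      using F j by (auto simp: mon_ideal_def QK)
  qed
  ultimately show ?thesis using g by (auto simp: L_def mon_ideal_def QK)
qed

lemma depth_ge:
  assumes tE: "t \<notin> E_set s"
  shows "enat s \<le> depth n (J :: ('k::field) mpoly set)"
proof -
  let ?k = "s - 1"
  have k: "?k < s" using s by simp
  let ?gs = "fs ?k @ [last_form :: 'k mpoly]"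
  note r = regular_seq_fs[OF k, where 'k='k, unfolded regular_seq_def]
  have lm: "last_form \<in> (max_ideal n :: 'k mpoly set)"
    unfolding last_form_def using s apex_less[of 0]
    by (intro is_ideal_add[OF is_ideal_max_ideal] is_ideal_sum[OF is_ideal_max_ideal] X_in_max_ideal index_less) auto
  have "regular_seq n J ?gs"
    unfolding regular_seq_def
  proof (intro conjI allI impI ballI)
    show m: "set ?gs \<subseteq> max_ideal n" using lm set_fs_max_ideal[OF k] by auto
    show "ideal_gen n (J \<union> set ?gs) \<noteq> Pn n" by (rule ideal_gen_neq_Pn[OF m])
    fix i g assume i: "i < length ?gs" and g: "g \<in> Pn n"
      and fg: "?gs ! i * g \<in> ideal_gen n (J \<union> set (take i ?gs))"
    show "g \<in> ideal_gen n (J \<union> set (take i ?gs))"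
    proof (cases "i < ?k")
      case True
      then show ?thesis
        using conjunct1[OF conjunct2[OF r], rule_format, of i g] g fg by (simp add: nth_append)
    next
      case False
      then have "i = ?k" using i by simp
      then show ?thesis
        using fg g last_form_regular[OF tE g] ideal_gen_fs[OF k, where 'k='k] by (simp add: nth_append)
    qed
  qed
  from regular_seq_le_depth[OF this] show ?thesis using s by simp
qed

lemma depth_eq:
  assumes tE: "t \<in> E_set s"
  shows "depth n (J :: ('k::field) mpoly set) = enat (s - 1)"
proof -
  let ?k = "s - 1"
  have k: "?k < s" using s by simp
  obtain v where v: "v * (s - 1) < t" "t \<le> v * s"
    using tE unfolding E_set_def by (auto simp: Suc_le_eq One_nat_def)
  \<comment> \<open>With all body exponents equal to \<open>v\<close>, each of the \<open>s\<close>
    blocks has deficit \<open>t - v * (s - 1)\<close>, which is positive. \<open>N\<close> is the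
    total deficit minus one, so \<open>u0\<close> just misses the ideal. An apex raises the supply
    by one and a body variable lowers the deficit by one, so every variable multiplies it into the
    ideal.\<close>
  define N where "N = s * (t - v * (s - 1)) - 1"
  define w where "w = (\<Sum>p\<in>{..<s} \<times> {1..<s}. single (fst p * s + snd p) v)"
  define u0 where "u0 = w + single 0 N"
  have lw: "lookup w (j * s + i) = (if i \<noteq> 0 then v else 0)" if "j < s" "i < s" for i j
  proof -
    have "lookup w (j * s + i) = (\<Sum>p\<in>{..<s} \<times> {1..<s}. if p = (j, i) then v else 0)"
      unfolding w_def lookup_sum
    proof (rule sum.cong[OF refl])
      fix p assume "p \<in> {..<s} \<times> {1..<s}"
      then show "lookup (single (fst p * s + snd p) v) (j * s + i) = (if p = (j, i) then v else 0)"
        using index_eq_iff[of "snd p" i "fst p" j] that by (auto simp: lookup_single when_def prod_eq_iff)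
    qed
    then show ?thesis using that by auto
  qed
  have kw: "keys w \<subseteq> {..<n}"
    unfolding w_def by (rule order.trans[OF keys_sum]) (auto intro!: index_less split: if_splits)
  have ku: "keys u0 \<subseteq> {..<n}"
    unfolding u0_def keys_plus_nat using kw s by auto
  have bw: "body j u0 = v * (s - 1)" if "j < s" for j
  proof -
    have "body j u0 = body j w"
      by (simp add: u0_def body_add body_single_apex[of j 0, simplified])
    also have "\<dots> = (\<Sum>i\<in>{1..<s}. v)"
      unfolding body_def using that by (intro sum.cong) (auto simp: lw)
    finally show ?thesis by (simp add: mult.commute)
  qed
  have apex: "lookup u0 (j * s) = (if j = 0 then N else 0)" if "j < s" for j
    using lw[OF that, of 0] s by (auto simp: u0_def lookup_add lookup_single when_def)
  have trans: "transversal_ok u0"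
  proof -
    have "(\<Sum>j<s. lookup w (j * s + \<tau> j)) = v * s" if \<tau>: "\<forall>j<s. \<tau> j \<in> {1..<s}" for \<tau>
    proof -
      have "(\<Sum>j<s. lookup w (j * s + \<tau> j)) = (\<Sum>j<s. v)"
      proof (rule sum.cong[OF refl])
        fix j assume "j \<in> {..<s}"
        then have "j < s" "\<tau> j < s" "\<tau> j \<noteq> 0" using \<tau> by fastforce+
        then show "lookup w (j * s + \<tau> j) = v" by (simp add: lw)
      qed
      then show ?thesis by (simp add: mult.commute)
    qed
    then have "transversal_ok w" using v(2) by (simp add: transversal_ok_def)
    then show ?thesis unfolding u0_def by (rule transversal_ok_add)
  qed
  have Qk: "Q ?k (merge_exp ?k m) \<longleftrightarrow>
      (\<Sum>j<s. t - body j m) \<le> (\<Sum>j<s. lookup m (j * s)) \<and> transversal_ok m" for m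
    by (auto simp: Q_merge_exp atMost_pred)
  have sb: "(\<Sum>j<s. t - body j u0) = Suc N"
    using v s by (simp add: bw N_def)
  have sa: "(\<Sum>j<s. lookup u0 (j * s)) = N"
  proof -
    have "(\<Sum>j<s. lookup u0 (j * s)) = (\<Sum>j<s. if j = 0 then N else 0)"
      by (rule sum.cong) (auto simp: apex)
    then show ?thesis using s by simp
  qed
  let ?u = "single u0 1 :: 'k mpoly"
  have "depth n (J :: 'k mpoly set) = enat (length (fs ?k :: 'k mpoly list))"
  proof (rule depth_eq_length[OF is_ideal_J regular_seq_fs[OF k], of ?u], unfold ideal_gen_fs[OF k])
    show "?u \<in> Pn n" using ku by (rule Pn_single)
    have "\<not> Q ?k (merge_exp ?k u0)" by (simp add: Qk sb sa)
    then show "?u \<notin> L ?k" by (simp add: L_def mon_ideal_def)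
    fix i assume "i < n"
    then obtain j l where i: "i = j * s + l" "j < s" "l < s" by (rule index_cases)
    let ?m = "u0 + single i 1"
    have "(\<Sum>j<s. t - body j ?m) \<le> (\<Sum>j<s. lookup ?m (j * s))"
    proof (cases "l = 0")
      case True
      have "(\<Sum>j'<s. lookup ?m (j' * s)) = N + (\<Sum>j'<s. if j' = j then 1 else 0)"
        unfolding lookup_add sum.distrib sa using s
        by (intro arg_cong2[where f="(+)"] sum.cong) (auto simp: i True lookup_single when_def)
      moreover have "body j' ?m = body j' u0" for j'
        using True by (simp add: i body_add body_single_apex)
      ultimately show ?thesis using i(2) by (simp add: sb)
    next
      case False
      have b: "body j' ?m = body j' u0 + (if j' = j then 1 else 0)" for j'
        using False body_single[OF i(3), of j' j 1] by (auto simp: i body_add)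
      have "(\<Sum>j'<s. t - body j' ?m) = (\<Sum>j'\<in>{..<s} - {j}. t - body j' u0) + (t - body j u0 - 1)"
        using i(2) by (subst sum.remove[of "{..<s}" j]) (auto simp: b)
      \<comment> \<open>The deficit of block \<open>j\<close> is positive, so the truncated
        subtraction of one is a genuine decrease.\<close>
      also have "\<dots> = N"
        using sb sum.remove[of "{..<s}" j "\<lambda>j. t - body j u0"] i(2) bw[OF i(2)] v(1) by simp
      also have "\<dots> \<le> (\<Sum>j<s. lookup ?m (j * s))"
        unfolding lookup_add sum.distrib sa by simp
      finally show ?thesis .
    qed
    then have "Q ?k (merge_exp ?k ?m)" using Qk transversal_ok_add[OF trans] by blast
    moreover have "X i * ?u = single ?m 1" by (simp add: X_def mult_single add.commute)
    moreover have "keys ?m \<subseteq> {..<n}" using ku \<open>i < n\<close> by (simp add: keys_plus_nat)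
    ultimately show "X i * ?u \<in> L ?k"
      using keys_merge_exp[of ?m ?k] by (simp add: L_def Pn_single single_in_mon_ideal)
  qed
  then show ?thesis by simp
qed

end

text \<open>The family \<open>covers\<close> depends on \<open>s\<close> alone, so the ideal is the
  same for every exponent. Stating this outside the locale allows two exponents to be
  compared.\<close>

lemma depth_symbolic_power:
  fixes s t :: nat
  defines "I \<equiv> ideal_gen (s * s) (cover_gens (s * s) (blocks.covers s)) :: ('k::field) mpoly set"
  assumes "2 \<le> s" "0 < t"
  shows "t \<in> E_set s \<Longrightarrow> depth (s * s) (symbolic_power (s * s) I t) = enat (s - 1)"
    and "t \<notin> E_set s \<Longrightarrow> enat s \<le> depth (s * s) (symbolic_power (s * s) I t)"
proof -
  interpret blocks s t by unfold_locales (use assms in auto)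
  interpret cf: cover_family "s * s" covers by (rule cover_family)
  have "covers \<noteq> {}" using s by (auto simp: covers_def)
  then have "symbolic_power (s * s) I t = J"
    unfolding I_def by (simp add: cf.symbolic_power_I covers_iff_Q J_def)
  then show "t \<in> E_set s \<Longrightarrow> depth (s * s) (symbolic_power (s * s) I t) = enat (s - 1)"
    "t \<notin> E_set s \<Longrightarrow> enat s \<le> depth (s * s) (symbolic_power (s * s) I t)"
    using depth_eq depth_ge by simp_all
qed

theorem theorem2p8:
  fixes s :: nat
  assumes "s \<ge> 3"
  shows "\<exists>(n::nat) (G :: ('k::field) mpoly set).
           finite G \<and> G \<subseteq> sqfree_monomials n \<and> ideal_gen n G \<noteq> Pn n \<and>
           (\<forall>t::nat. t > 0 \<longrightarrow>
              (depth n (symbolic_power n (ideal_gen n G) s)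
                 < depth n (symbolic_power n (ideal_gen n G) t)
               \<longleftrightarrow> t \<notin> E_set s))"
proof (intro exI conjI allI impI)
  let ?n = "s * s"
  let ?G = "cover_gens ?n (blocks.covers s) :: 'k mpoly set"
  interpret blocks s s by unfold_locales (use assms in auto)
  interpret cf: cover_family ?n covers by (rule cover_family)
  have s2: "2 \<le> s" "0 < s" using assms by auto
  show "finite ?G" by (rule finite_cover_gens)
  show "?G \<subseteq> sqfree_monomials ?n" by (rule cover_gens_sqfree)
  have "covers \<noteq> {}" using s2 by (auto simp: covers_def)
  then show "ideal_gen ?n ?G \<noteq> Pn ?n" by (rule cf.I_proper)
  fix t :: nat assume t: "t > 0"
  \<comment> \<open>For \<open>i = 1\<close> the interval from \<open>i * (s - 1) + 1\<close> to
    \<open>i * s\<close> consists of \<open>s\<close> alone. Hence the power with exponent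
    \<open>s\<close> has depth \<open>s - 1\<close>.\<close>
  have "s \<in> E_set s" using s2 by (intro E_setI[of 1]) auto
  note ds = depth_symbolic_power(1)[OF s2 this, where 'k='k]
  have "enat (s - 1) < enat s" using s2 by simp
  then show "depth ?n (symbolic_power ?n (ideal_gen ?n ?G) s)
      < depth ?n (symbolic_power ?n (ideal_gen ?n ?G) t) \<longleftrightarrow> t \<notin> E_set s"
    using ds depth_symbolic_power[OF s2(1) t, where 'k='k]
    by (cases "t \<in> E_set s") (metis less_irrefl, metis less_le_trans)
qed

end
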